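(* Let $a,b$ be coprime positive integers with $(a,b)\ne(1,1)$ and let $c=a+b$. Let $r=\omega(abc)-1$ (so $r\ge1$). For any list of $\mathbb{Z}$-linearly independent derivations $\psi_1,\dots,\psi_r\in\mathscr{T}(a,b)$ there is at least one index $1\le i_0\le r$ such that $a,b$ are $\psi_{i_0}$-independent. Furthermore, if the $\psi_1,\dots,\psi_r$ are chosen to satisfy in addition $\prod_{i=1}^r\|\psi_i\|\le\frac{\omega(abc)}{2\log2}\cdot c\log c$ (such a choice exists), then $$\|\psi_{i_0}\|\le\frac{\omega(abc)}{2\log 2}\cdot c\log c.$$
   Context: For a prime $p$, $v_p$ is the $p$-adic valuation. For a non-zero integer $n$, $\mathrm{supp}(n)$ is the set of primes dividing $n$ and $\omega(n)=\#\mathrm{supp}(n)$. Let $\Omega$ be the free $\mathbb{Z}$-module on symbols $\xi_p$, one for each prime $p$. Define $\mathrm{d}:\mathbb{Z}\to\Omega$ by $\mathrm{d}0=0$ and $\mathrm{d}n=\sum_{p\mid n}\frac{n\,v_p(n)}{p}\,\xi_p$ for $n\ne 0$ (the coefficients are integers). For a $\mathbb{Z}$-linear map $\psi:\Omega\to\mathbb{Z}$ put $\|\psi\|=\sup_p|\psi(\xi_p)|$. Let $\mathscr{T}$ be the $\mathbb{Z}$-module of all $\mathbb{Z}$-linear $\psi:\Omega\to\mathbb{Z}$ with $\|\psi\|<\infty$; its elements are called derivations. For $\psi\in\mathscr{T}$ let $\mathrm{d}^\psi=\psi\circ\mathrm{d}:\mathbb{Z}\to\mathbb{Z}$ and $\mathrm{supp}(\psi)=\{p:\psi(\xi_p)\neq0\}$.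 For positive integers $a,b$, $$\mathscr{T}(a,b)=\{\psi\in\mathscr{T}:\ \mathrm{supp}(\psi)\subseteq\mathrm{supp}(ab(a+b))\ \text{and}\ \mathrm{d}^\psi(a+b)=\mathrm{d}^\psi a+\mathrm{d}^\psi b\}.$$ Integers $a,b$ are $\psi$-independent if $W^\psi(a,b):=a\,\mathrm{d}^\psi b-b\,\mathrm{d}^\psi a\neq 0$. *)

theory Defs
  imports
    Complex_Main
    "HOL-Computational_Algebra.Primes"
    "HOL-Library.Poly_Mapping"
    "HOL-Library.Function_Algebras"
begin

typedef prime_nat = "{p :: nat. prime p}"
  morphisms nat_of_prime Prime_nat
  using two_is_prime_nat by blast

abbreviation int_of_prime :: "prime_nat \<Rightarrow> int"
  where "int_of_prime p \<equiv> int (nat_of_prime p)"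

text \<open>The free \<open>\<int>\<close>-module \<open>\<Omega>\<close> on the symbols \<open>\<xi>\<^sub>p\<close>; here \<open>\<xi>\<^sub>p\<close> is \<^term>\<open>frag_of p\<close> and
  the scalar multiplication is \<^const>\<open>frag_cmul\<close>.\<close>

type_synonym omega = "prime_nat \<Rightarrow>\<^sub>0 int"

definition int_supp :: "int \<Rightarrow> prime_nat set"
  where "int_supp n = {p. int_of_prime p dvd n}"

text \<open>Only meaningful for \<open>n \<noteq> 0\<close>, since \<^term>\<open>int_supp 0\<close> is infinite.\<close>

definition omega_count :: "int \<Rightarrow> nat"
  where "omega_count n = card (int_supp n)"

text \<open>For \<open>p\<close> dividing \<open>n\<close> the integer division below is exact.\<close>

definition abs_d :: "int \<Rightarrow> omega"
  where "abs_d n =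
    (if n = 0 then 0
     else \<Sum>p\<in>int_supp n.
       frag_cmul ((n * int (multiplicity (int_of_prime p) n)) div int_of_prime p) (frag_of p))"

definition deriv_norm :: "(omega \<Rightarrow> int) \<Rightarrow> real"
  where "deriv_norm \<psi> = (SUP p. \<bar>real_of_int (\<psi> (frag_of p))\<bar>)"

text \<open>The supremum is taken in the reals, so its finiteness is expressed by boundedness.\<close>

definition derivations :: "(omega \<Rightarrow> int) set"
  where "derivations =
    {\<psi>. module_hom frag_cmul (*) \<psi> \<and> bdd_above (range (\<lambda>p. \<bar>real_of_int (\<psi> (frag_of p))\<bar>))}"

definition d_psi :: "(omega \<Rightarrow> int) \<Rightarrow> int \<Rightarrow> int"
  where "d_psi \<psi> = \<psi> \<circ> abs_d"

definition deriv_supp :: "(omega \<Rightarrow> int) \<Rightarrow> prime_nat set"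
  where "deriv_supp \<psi> = {p. \<psi> (frag_of p) \<noteq> 0}"

definition derivations_at :: "int \<Rightarrow> int \<Rightarrow> (omega \<Rightarrow> int) set"
  where "derivations_at a b =
    {\<psi> \<in> derivations. deriv_supp \<psi> \<subseteq> int_supp (a * b * (a + b)) \<and>
      d_psi \<psi> (a + b) = d_psi \<psi> a + d_psi \<psi> b}"

definition wronskian :: "(omega \<Rightarrow> int) \<Rightarrow> int \<Rightarrow> int \<Rightarrow> int"
  where "wronskian \<psi> a b = a * d_psi \<psi> b - b * d_psi \<psi> a"

definition psi_independent :: "(omega \<Rightarrow> int) \<Rightarrow> int \<Rightarrow> int \<Rightarrow> bool"
  where "psi_independent \<psi> a b \<longleftrightarrow> wronskian \<psi> a b \<noteq> 0"

definition fun_scale :: "int \<Rightarrow> ('a \<Rightarrow> int) \<Rightarrow> 'a \<Rightarrow> int"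
  where "fun_scale k f = (\<lambda>x. k * f x)"

interpretation int_fun: module fun_scale
  by standard (auto simp: fun_scale_def algebra_simps)

lemma module_frag_cmul: "module frag_cmul"
  by standard (simp_all add: frag_cmul_distrib frag_cmul_distrib2)

lemma module_int: "module ((*) :: int \<Rightarrow> int \<Rightarrow> int)"
  by standard (simp_all add: algebra_simps)

lemma omega_linear_iff:
  "module_hom frag_cmul (*) \<psi> \<longleftrightarrow>
    (\<forall>x y. \<psi> (x + y) = \<psi> x + \<psi> y) \<and> (\<forall>k x. \<psi> (frag_cmul k x) = k * \<psi> x)"
  for \<psi> :: "omega \<Rightarrow> int"
  by (auto simp: module_hom_def module_hom_axioms_def module_frag_cmul module_int)

text \<open>Linear independence over \<open>\<int>\<close> of a list \<open>\<psi>\<^sub>1, \<dots>, \<psi>\<^sub>r\<close>. Independence in the library is a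
  property of sets, so repetitions are excluded separately.\<close>

definition list_independent :: "nat \<Rightarrow> (nat \<Rightarrow> 'a \<Rightarrow> int) \<Rightarrow> bool"
  where "list_independent r \<psi> \<longleftrightarrow> inj_on \<psi> {1..r} \<and> int_fun.independent (\<psi> ` {1..r})"

lemma list_independent_iff:
  "list_independent r \<psi> \<longleftrightarrow>
    (\<forall>k. (\<forall>x. (\<Sum>i=1..r. k i * \<psi> i x) = 0) \<longrightarrow> (\<forall>i\<in>{1..r}. k i = 0))"
proof
  assume L: "list_independent r \<psi>"
  then have inj: "inj_on \<psi> {1..r}" and ind: "int_fun.independent (\<psi> ` {1..r})"
    by (auto simp: list_independent_def)
  show "\<forall>k. (\<forall>x. (\<Sum>i=1..r. k i * \<psi> i x) = 0) \<longrightarrow> (\<forall>i\<in>{1..r}. k i = 0)"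
  proof (intro allI impI ballI)
    fix k i assume k: "\<forall>x. (\<Sum>i=1..r. k i * \<psi> i x) = 0" and i: "i \<in> {1..r}"
    let ?u = "\<lambda>v. k (the_inv_into {1..r} \<psi> v)"
    have "(\<Sum>v\<in>\<psi> ` {1..r}. fun_scale (?u v) v) = (\<Sum>i\<in>{1..r}. fun_scale (k i) (\<psi> i))"
      unfolding sum.reindex[OF inj] comp_def
      by (rule sum.cong) (simp_all only: the_inv_into_f_f[OF inj])
    also have "\<dots> = 0"
    proof
      fix x
      have "(\<Sum>i\<in>A. fun_scale (k i) (\<psi> i)) x = (\<Sum>i\<in>A. k i * \<psi> i x)" if "finite A" for A
        using that by (induction A) (auto simp: fun_scale_def)
      then show "(\<Sum>i\<in>{1..r}. fun_scale (k i) (\<psi> i)) x = 0 x"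
        using k by simp
    qed
    finally have "?u (\<psi> i) = 0"
      using int_fun.independentD[OF ind _ subset_refl, of ?u "\<psi> i"] i by simp
    then show "k i = 0"
      by (simp only: the_inv_into_f_f[OF inj i])
  qed
next
  assume R: "\<forall>k. (\<forall>x. (\<Sum>i=1..r. k i * \<psi> i x) = 0) \<longrightarrow> (\<forall>i\<in>{1..r}. k i = 0)"
  have inj: "inj_on \<psi> {1..r}"
  proof (rule inj_onI, rule ccontr)
    fix i j assume ij: "i \<in> {1..r}" "j \<in> {1..r}" "\<psi> i = \<psi> j" "i \<noteq> j"
    let ?k = "\<lambda>l. (if l = i then 1 else 0) - (if l = j then 1 else 0) :: int"
    have "(\<Sum>l=1..r. ?k l * \<psi> l x) = \<psi> i x - \<psi> j x" for x
    proof -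
      have "(\<Sum>l=1..r. ?k l * \<psi> l x) =
        (\<Sum>l=1..r. if l = i then \<psi> i x else 0) - (\<Sum>l=1..r. if l = j then \<psi> j x else 0)"
        unfolding sum_subtractf[symmetric] by (rule sum.cong) auto
      then show ?thesis using ij by simp
    qed
    then have "\<forall>x. (\<Sum>l=1..r. ?k l * \<psi> l x) = 0"
      using ij(3) by simp
    then have "\<forall>l\<in>{1..r}. ?k l = 0"
      using R[THEN spec, of ?k] by (rule rev_mp)
    then have "?k i = 0"
      using ij(1) by (rule bspec)
    then show False using ij(4) by simp
  qed
  moreover have "int_fun.independent (\<psi> ` {1..r})"
  proof
    assume "int_fun.dependent (\<psi> ` {1..r})"
    then obtain t u where t: "t \<subseteq> \<psi> ` {1..r}" "(\<Sum>v\<in>t. fun_scale (u v) v) = 0" "\<exists>v\<in>t. u v \<noteq> 0"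
      unfolding int_fun.dependent_explicit by blast
    define w where "w v = (if v \<in> t then u v else 0)" for v
    have *: "(\<Sum>v\<in>A. fun_scale (w v) v) x = (\<Sum>v\<in>A. w v * v x)" if "finite A" for A x
      using that by (induction A) (auto simp: fun_scale_def)
    have ft: "finite t" using t(1) finite_surj by blast
    have "(\<Sum>i=1..r. w (\<psi> i) * \<psi> i x) = 0" for x
    proof -
      have "(\<Sum>i=1..r. w (\<psi> i) * \<psi> i x) = (\<Sum>v\<in>\<psi> ` {1..r}. w v * v x)"
        by (simp only: sum.reindex[OF inj] comp_def)
      also have "\<dots> = (\<Sum>v\<in>t. w v * v x)"
        by (rule sum.mono_neutral_right) (use t(1) in \<open>auto simp: w_def\<close>)
      also have "\<dots> = (\<Sum>v\<in>t. fun_scale (w v) v) x"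
        using *[OF ft] by simp
      also have "(\<Sum>v\<in>t. fun_scale (w v) v) = (\<Sum>v\<in>t. fun_scale (u v) v)"
        by (rule sum.cong) (auto simp: w_def)
      finally show ?thesis using t(2) by simp
    qed
    then have "\<forall>i\<in>{1..r}. w (\<psi> i) = 0"
      using R[THEN spec, of "\<lambda>i. w (\<psi> i)"] by simp
    then have "\<forall>v\<in>t. u v = 0"
      using t(1) by (fastforce simp: w_def)
    then show False using t(3) by simp
  qed
  ultimately show "list_independent r \<psi>"
    by (simp add: list_independent_def)
qed

end

(*
  A derivation supported on S = supp(abc) is an integer vector indexed by S, and additivity on (a, b) says
  that it is orthogonal to a vector A with non-zero entries n v_p(n)/p (up to sign), n in {a, b, c}. Vanishing
  of the Wronskian is a second, independent linear condition, so r = |S| - 1 independent derivations cannot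
  all satisfy it; and independent integral derivations have norm at least 1, so that each norm is bounded by
  the product.

  The existence of a small independent system is Minkowski's second theorem for the sup norm on the lattice L
  orthogonal to A:
  there are independent x_1, ..., x_r in L with the product of the norms at most |A|_1. It is proved by counting
  the values of the form A on {0, ..., t-1}^S. If V is the saturated span of the vectors of L of norm at most t,
  of corank d, the number of classes modulo V grows at least by the factor ((t+1)/t)^d from side t to side t+1,
  and on these boxes classes modulo V and values of A are the same. Starting from t = 1, each new minimum
  lowers d by one and contributes a factor t, which ends with t * (product of the norms) <= |A|_1 (t-1) + 1.
*)
theory Submission
  imports Defs "HOL-Library.FuncSet"
begin

subsection \<open>Counting images of integer boxes\<close>

text \<open>Vanishing outside \<open>I\<close> identifies the total functions with the points of
  \<int> to the power \<open>I\<close>, so the box is finite.\<close>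

definition zbox :: "'i set \<Rightarrow> int \<Rightarrow> int \<Rightarrow> ('i \<Rightarrow> int) set"
  where "zbox I l h = {x. (\<forall>i\<in>I. l \<le> x i \<and> x i < h) \<and> (\<forall>i. i \<notin> I \<longrightarrow> x i = 0)}"

definition mat_vec :: "'i set \<Rightarrow> ('j \<Rightarrow> 'i \<Rightarrow> int) \<Rightarrow> ('i \<Rightarrow> int) \<Rightarrow> 'j \<Rightarrow> int"
  where "mat_vec I M x = (\<lambda>p. \<Sum>i\<in>I. M p i * x i)"

lemma zboxI:
  assumes "\<And>i. i \<in> I \<Longrightarrow> l \<le> x i" "\<And>i. i \<in> I \<Longrightarrow> x i < h" "\<And>i. i \<notin> I \<Longrightarrow> x i = 0"
  shows "x \<in> zbox I l h"
  using assms by (simp add: zbox_def)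

lemma zboxD:
  assumes "x \<in> zbox I l h"
  shows "i \<in> I \<Longrightarrow> l \<le> x i" "i \<in> I \<Longrightarrow> x i < h" "i \<notin> I \<Longrightarrow> x i = 0"
  using assms by (simp_all add: zbox_def)

lemma zbox_mono: "l' \<le> l \<Longrightarrow> h \<le> h' \<Longrightarrow> zbox I l h \<subseteq> zbox I l' h'"
  by (force simp: zbox_def)

lemma bij_betw_zbox_PiE:
  "bij_betw (\<lambda>x. restrict x I) (zbox I l h) (PiE I (\<lambda>_. {l..<h}))"
proof (rule bij_betw_byWitness[where f' = "\<lambda>y i. if i \<in> I then y i else 0"])
  show "\<forall>x\<in>zbox I l h. (\<lambda>i. if i \<in> I then restrict x I i else 0) = x"
    by (auto simp: zbox_def)
  show "\<forall>y\<in>PiE I (\<lambda>_. {l..<h}). restrict (\<lambda>i. if i \<in> I then y i else 0) I = y"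
    by (auto simp: fun_eq_iff restrict_def PiE_def extensional_def)
  show "(\<lambda>x. restrict x I) ` zbox I l h \<subseteq> PiE I (\<lambda>_. {l..<h})"
    by (auto simp: zbox_def)
  show "(\<lambda>y i. if i \<in> I then y i else 0) ` PiE I (\<lambda>_. {l..<h}) \<subseteq> zbox I l h"
    by (force simp: zbox_def PiE_def Pi_def)
qed

lemma finite_zbox: "finite I \<Longrightarrow> finite (zbox I l h)"
  using bij_betw_finite[OF bij_betw_zbox_PiE[of I l h]] by (simp add: finite_PiE)

lemma card_zbox: "finite I \<Longrightarrow> card (zbox I l h) = nat (h - l) ^ card I"
  using bij_betw_same_card[OF bij_betw_zbox_PiE[of I l h]] by (simp add: card_PiE)

lemma mat_vec_add: "mat_vec I M (x + y) = mat_vec I M x + mat_vec I M y"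
  by (simp add: mat_vec_def fun_eq_iff sum.distrib distrib_left)

lemma mat_vec_diff: "mat_vec I M (x - y) = mat_vec I M x - mat_vec I M y"
  by (simp add: mat_vec_def fun_eq_iff sum_subtractf right_diff_distrib)

lemma mat_vec_scale: "mat_vec I M (\<lambda>i. k * x i) = (\<lambda>p. k * mat_vec I M x p)"
  by (simp add: mat_vec_def fun_eq_iff sum_distrib_left mult.left_commute)

lemma mat_vec_lin: "mat_vec I M (\<lambda>i. k * x i + y i) p = k * mat_vec I M x p + mat_vec I M y p"
  by (simp add: mat_vec_def sum_distrib_left sum.distrib distrib_left mult.left_commute)

lemma mat_vec_bound:
  assumes "\<And>i. i \<in> I \<Longrightarrow> \<bar>x i\<bar> \<le> b"
  shows "\<bar>mat_vec I M x p\<bar> \<le> (\<Sum>i\<in>I. \<bar>M p i\<bar>) * b"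
proof -
  have "\<bar>mat_vec I M x p\<bar> \<le> (\<Sum>i\<in>I. \<bar>M p i * x i\<bar>)"
    by (simp add: mat_vec_def sum_abs)
  also have "\<dots> \<le> (\<Sum>i\<in>I. \<bar>M p i\<bar> * b)"
    by (intro sum_mono) (simp add: abs_mult mult_left_mono assms)
  finally show ?thesis by (simp add: sum_distrib_right)
qed

text \<open>Two points have the same value of \<^term>\<open>res_im I M N\<close> iff they are congruent modulo
  \<open>N \<cdot> ker M\<close>; for large \<open>N\<close> counting these values approximates a volume computation.\<close>

definition res_im :: "'i set \<Rightarrow> ('j \<Rightarrow> 'i \<Rightarrow> int) \<Rightarrow> int \<Rightarrow> ('i \<Rightarrow> int) \<Rightarrow> ('i \<Rightarrow> int) \<times> ('j \<Rightarrow> int)"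
  where "res_im I M N x = (\<lambda>i. x i mod N, mat_vec I M x)"

text \<open>Division with remainder by \<open>N\<close> splits a point of the large box into
  residues, a point of the box of side \<open>N\<close>, and a quotient in the box of side
  \<open>t\<close>. The value of \<open>res_im\<close> amounts to the residues together with the
  image of the quotient, which vary independently.\<close>

lemma card_res_im_zbox:
  assumes fI: "finite I" and N: "N > 0" and t: "t > 0"
  shows "card (res_im I M N ` zbox I 0 (N * t)) = nat N ^ card I * card (mat_vec I M ` zbox I 0 t)"
proof -
  define g where "g = (\<lambda>(s, y). (s :: 'a \<Rightarrow> int, \<lambda>p. N * y p + mat_vec I M s p))"
  have gP: "g (s, mat_vec I M x) = res_im I M N (\<lambda>i. N * x i + s i)" if "s \<in> zbox I 0 N" for s x
  proof -
    have "(\<lambda>i. (N * x i + s i) mod N) = s"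
    proof
      fix i
      show "(N * x i + s i) mod N = s i"
        using zboxD[OF that, of i] by (cases "i \<in> I") simp_all
    qed
    then show ?thesis
      by (simp add: g_def res_im_def mat_vec_lin fun_eq_iff)
  qed
  have "res_im I M N ` zbox I 0 (N * t) = g ` (zbox I 0 N \<times> mat_vec I M ` zbox I 0 t)"
  proof (rule set_eqI, rule iffI)
    fix z assume "z \<in> res_im I M N ` zbox I 0 (N * t)"
    then obtain X where X: "X \<in> zbox I 0 (N * t)" and z: "z = res_im I M N X" ..
    define s where "s = (\<lambda>i. X i mod N)"
    define x where "x = (\<lambda>i. X i div N)"
    have s: "s \<in> zbox I 0 N"
      by (rule zboxI) (use N zboxD[OF X] in \<open>simp_all add: s_def\<close>)
    have x: "x \<in> zbox I 0 t"
    proof (rule zboxI)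
      fix i assume "i \<in> I"
      then have b: "0 \<le> X i" "X i < N * t" using zboxD[OF X] by blast+
      then show "0 \<le> x i" using N by (simp add: x_def pos_imp_zdiv_nonneg_iff)
      have "N * x i \<le> X i" using N by (simp add: x_def flip: minus_mod_eq_mult_div)
      then have "N * x i < N * t" using b by simp
      then show "x i < t" using N by simp
    next
      fix i assume "i \<notin> I"
      then show "x i = 0" using zboxD(3)[OF X] by (simp add: x_def)
    qed
    have "z = g (s, mat_vec I M x)"
      unfolding gP[OF s] z by (simp add: s_def x_def)
    then show "z \<in> g ` (zbox I 0 N \<times> mat_vec I M ` zbox I 0 t)"
      using s x by simp
  next
    fix z assume "z \<in> g ` (zbox I 0 N \<times> mat_vec I M ` zbox I 0 t)"
    then obtain s x where s: "s \<in> zbox I 0 N" and x: "x \<in> zbox I 0 t" and z: "z = g (s, mat_vec I M x)"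
      by (elim imageE SigmaE) simp
    have "(\<lambda>i. N * x i + s i) \<in> zbox I 0 (N * t)"
    proof (rule zboxI)
      fix i assume i: "i \<in> I"
      then have b: "0 \<le> x i" "x i \<le> t - 1" "0 \<le> s i" "s i < N" using zboxD[OF x] zboxD[OF s] by force+
      show "0 \<le> N * x i + s i" using b N by simp
      have "N * x i \<le> N * (t - 1)" using b N by simp
      then show "N * x i + s i < N * t" using b by (simp add: algebra_simps)
    next
      fix i assume "i \<notin> I"
      then show "N * x i + s i = 0" using zboxD(3)[OF x] zboxD(3)[OF s] by simp
    qed
    then show "z \<in> res_im I M N ` zbox I 0 (N * t)"
      unfolding z gP[OF s] by (rule imageI)
  qed
  moreover have "inj_on g A" for A
    by (rule inj_onI) (use N in \<open>auto simp: g_def fun_eq_iff\<close>)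
  ultimately show ?thesis
    using fI N by (simp add: card_image card_cartesian_product card_zbox)
qed

text \<open>Each point of the shell between the two boxes adds at most one value, and for fixed
  \<open>K\<close> the number of these points is of lower order than \<open>N ^ card I\<close>. The
  additive form avoids truncated subtraction.\<close>

lemma card_res_im_thickened:
  assumes fI: "finite I" and N: "N > 0" and t: "t > 0" and K: "K \<ge> 0"
  shows "card (res_im I M N ` zbox I (- K) (N * t + K)) + nat (N * t) ^ card I \<le>
    nat N ^ card I * card (mat_vec I M ` zbox I 0 t) + nat (N * t + 2 * K) ^ card I"
proof -
  let ?A = "zbox I (- K) (N * t + K)" and ?B = "zbox I 0 (N * t)"
  have BA: "?B \<subseteq> ?A" using K by (intro zbox_mono) auto
  have fA: "finite ?A" "finite ?B" using fI by (simp_all add: finite_zbox)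
  have "res_im I M N ` ?A = res_im I M N ` ?B \<union> res_im I M N ` (?A - ?B)"
    using BA by blast
  then have "card (res_im I M N ` ?A) \<le> card (res_im I M N ` ?B) + card (res_im I M N ` (?A - ?B))"
    by (simp add: card_Un_le)
  also have "card (res_im I M N ` (?A - ?B)) \<le> card (?A - ?B)"
    using fA by (intro card_image_le) simp
  also have "card (?A - ?B) = card ?A - card ?B"
    using fA BA by (simp add: card_Diff_subset)
  finally have "card (res_im I M N ` ?A) + card ?B \<le> card (res_im I M N ` ?B) + card ?A"
    using card_mono[OF fA(1) BA] by simp
  moreover have "card ?A = nat (N * t + 2 * K) ^ card I" "card ?B = nat (N * t) ^ card I"
    using fI by (simp_all add: card_zbox add.commute)
  ultimately show ?thesis
    by (simp add: card_res_im_zbox[OF fI N t])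
qed

text \<open>A saturated subgroup \<open>V\<close> of \<open>\<int>\<^sup>I\<close> is given as the kernel of a matrix which on the coordinates
  \<open>J\<close>, complementary to \<open>V\<close>, is \<open>m\<close> times the identity. Counting classes modulo \<open>V\<close> then amounts to
  counting images.\<close>

definition pivoted :: "'i set \<Rightarrow> 'i set \<Rightarrow> int \<Rightarrow> ('i \<Rightarrow> 'i \<Rightarrow> int) \<Rightarrow> bool"
  where "pivoted I J m M \<longleftrightarrow> finite I \<and> J \<subseteq> I \<and> m > 0 \<and>
    (\<forall>p i. p \<notin> J \<longrightarrow> M p i = 0) \<and> (\<forall>p\<in>J. \<forall>i\<in>J. M p i = (if p = i then m else 0))"

lemma pivoted_mat_vec_outside: "pivoted I J m M \<Longrightarrow> p \<notin> J \<Longrightarrow> mat_vec I M x p = 0"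
  by (simp add: pivoted_def mat_vec_def)

text \<open>On \<open>J\<close> the matrix is diagonal. Since \<open>mat_vec I M z\<close> is itself
  supported on \<open>J\<close>, applying \<open>M\<close> twice to \<open>z\<close> multiplies
  \<open>mat_vec I M z\<close> by \<open>m\<close>.\<close>

lemma pivoted_mat_vec_supported:
  assumes pv: "pivoted I J m M" and x: "\<And>i. i \<notin> J \<Longrightarrow> x i = 0"
  shows "mat_vec I M x = (\<lambda>i. m * x i)"
proof
  fix p
  have fin: "finite I" "J \<subseteq> I" using pv by (simp_all add: pivoted_def)
  have "mat_vec I M x p = (\<Sum>i\<in>J. M p i * x i)"
    unfolding mat_vec_def using fin x by (intro sum.mono_neutral_right) auto
  also have "\<dots> = (\<Sum>i\<in>J. if p = i then m * x i else 0)"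
    by (intro sum.cong refl, cases "p \<in> J") (use pv x in \<open>auto simp: pivoted_def\<close>)
  also have "\<dots> = m * x p"
    using finite_subset[OF fin(2,1)] x by simp
  finally show "mat_vec I M x p = m * x p" .
qed

lemma sum_abs_row_le:
  assumes pv: "pivoted I J m M"
  shows "(\<Sum>i\<in>I. \<bar>M p i\<bar>) \<le> (\<Sum>q\<in>I. \<Sum>i\<in>I. \<bar>M q i\<bar>)"
proof (cases "p \<in> I")
  case True
  then show ?thesis
    using pv by (intro member_le_sum[of p I "\<lambda>p. \<Sum>i\<in>I. \<bar>M p i\<bar>"]) (auto simp: pivoted_def intro: sum_nonneg)
next
  case False
  then have "p \<notin> J" using pv by (auto simp: pivoted_def)
  then have "\<And>i. M p i = 0" using pv by (simp add: pivoted_def)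
  then show ?thesis by (simp add: sum_nonneg)
qed

text \<open>The point \<open>q\<close> approximates \<open>x/t\<close> up to an error independent of \<open>x\<close>, while its image is an exactly
  prescribed rounding: \<open>m z - M z\<close> lies in the kernel and \<open>w\<close> is supported on \<open>J\<close>.\<close>

lemma scaled_point:
  fixes x :: "'i \<Rightarrow> int"
  assumes pv: "pivoted I J m M" and t: "t > 0" and e: "e \<in> zbox J 0 (t + 1)"
  defines "y \<equiv> mat_vec I M x"
  defines "w \<equiv> \<lambda>i. (y i div m + e i) div t"
  defines "z \<equiv> \<lambda>i. x i div (m * t)"
  defines "q \<equiv> \<lambda>i. w i + m * z i - mat_vec I M z i"
  defines "K \<equiv> m + (\<Sum>p\<in>I. \<Sum>i\<in>I. \<bar>M p i\<bar>) + 2"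
  shows "mat_vec I M q = (\<lambda>i. m * w i)" and "\<bar>t * q i - x i\<bar> \<le> t * K"
proof -
  have m: "m > 0" using pv by (simp add: pivoted_def)
  have mt: "m * t > 0" using m t by simp
  have w0: "w i = 0" if "i \<notin> J" for i
    using that zboxD(3)[OF e that] pivoted_mat_vec_outside[OF pv that, of x] by (simp add: w_def y_def)
  have Pw: "mat_vec I M w = (\<lambda>i. m * w i)"
    by (rule pivoted_mat_vec_supported[OF pv w0])
  have PP: "mat_vec I M (mat_vec I M z) = (\<lambda>i. m * mat_vec I M z i)"
    by (rule pivoted_mat_vec_supported[OF pv pivoted_mat_vec_outside[OF pv]])
  have "q = (\<lambda>i. m * z i + w i) - mat_vec I M z"
    by (simp add: q_def fun_eq_iff)
  then have "mat_vec I M q = mat_vec I M (\<lambda>i. m * z i + w i) - mat_vec I M (mat_vec I M z)"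
    by (simp only: mat_vec_diff)
  then show "mat_vec I M q = (\<lambda>i. m * w i)"
    unfolding PP by (simp add: fun_eq_iff mat_vec_lin Pw)
  show "\<bar>t * q i - x i\<bar> \<le> t * K"
  proof -
    define rm where "rm = (\<lambda>i. x i mod (m * t))"
    define C where "C = (\<Sum>p\<in>I. \<Sum>i\<in>I. \<bar>M p i\<bar>)"
    have xr: "x i = m * t * z i + rm i" for i
      unfolding z_def rm_def by simp
    have rm: "0 \<le> rm i" "rm i < m * t" for i
      using mt by (simp_all add: rm_def)
    have "x = (\<lambda>i. m * t * z i + rm i)" using xr by (rule ext)
    then have yz: "y i = m * t * mat_vec I M z i + mat_vec I M rm i"
      unfolding y_def using mat_vec_lin[of I M "m * t" z rm i] by simp
    have "\<bar>mat_vec I M rm i\<bar> \<le> (\<Sum>k\<in>I. \<bar>M i k\<bar>) * (m * t)"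
      by (rule mat_vec_bound) (use rm in \<open>simp add: less_imp_le\<close>)
    also have "\<dots> \<le> C * (m * t)"
      unfolding C_def using mt by (intro mult_right_mono sum_abs_row_le[OF pv]) simp
    finally have Prm: "\<bar>mat_vec I M rm i\<bar> \<le> C * (m * t)" .
    show ?thesis
    proof (cases "i \<in> J")
      case False
      have "t * q i - x i = - rm i"
        unfolding q_def w0[OF False] pivoted_mat_vec_outside[OF pv False] xr[of i]
        by (simp add: algebra_simps)
      moreover have "m * t \<le> t * K"
        unfolding K_def using t sum_nonneg[of I "\<lambda>p. \<Sum>i\<in>I. \<bar>M p i\<bar>"]
        by (simp add: sum_nonneg distrib_left mult.commute)
      ultimately show ?thesis using rm[of i] by linarith
    next
      case True
      define r1 where "r1 = y i mod m"
      define r2 where "r2 = (y i div m + e i) mod t"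
      have r1: "0 \<le> r1" "r1 < m" using m by (simp_all add: r1_def)
      have r2: "0 \<le> r2" "r2 < t" using t by (simp_all add: r2_def)
      have ei: "0 \<le> e i" "e i \<le> t" using zboxD(1,2)[OF e True] by simp_all
      have tw: "t * w i = y i div m + e i - r2"
        unfolding w_def r2_def by (simp add: minus_mod_eq_mult_div)
      have my: "m * (y i div m) = y i - r1"
        unfolding r1_def by (simp add: minus_mod_eq_mult_div)
      have "m * (t * w i) = y i - r1 + m * e i - m * r2"
        unfolding tw using my by (simp add: algebra_simps)
      \<comment> \<open>Multiplied by \<open>m\<close>, the terms with \<open>mat_vec I M z\<close>
        cancel, and only the remainders of the three divisions and the digit \<open>e i\<close> are
        left.\<close>
      then have eq: "m * (t * q i - x i) = mat_vec I M rm i - r1 + m * e i - m * r2 - m * rm i"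
        unfolding q_def xr[of i] using yz by (simp add: algebra_simps)
      have "0 \<le> m * e i" "m * e i \<le> m * t" "0 \<le> m * r2" "m * r2 \<le> m * t" "0 \<le> m * rm i" "m * rm i \<le> m * (m * t)"
        using m ei r2 rm[of i] by (simp_all add: less_imp_le)
      moreover have "m \<le> m * t" using m t by simp
      ultimately have "\<bar>m * (t * q i - x i)\<bar> \<le> C * (m * t) + m * (m * t) + 2 * (m * t)"
        unfolding eq using Prm r1 by linarith
      \<comment> \<open>\<open>K\<close> is chosen to make this an equality.\<close>
      also have "\<dots> = m * (t * K)"
        by (simp add: K_def C_def algebra_simps)
      finally show ?thesis using m by (simp add: abs_mult)
    qed
  qed
qed

text \<open>Since \<open>a div m + e = t w + e'\<close>, the sum \<open>a div m + w\<close> determines \<open>(t + 1) w - e\<close>, from which \<open>w\<close>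
  and \<open>e\<close> are read off because \<open>e\<close> ranges over \<open>t + 1\<close> consecutive values.\<close>

lemma shift_inj:
  fixes a a' e e' t m :: int
  assumes m: "m > 0" and t: "t > 0" and e: "0 \<le> e" "e \<le> t" "0 \<le> e'" "e' \<le> t"
    and 1: "a + m * ((a div m + e) div t) = a' + m * ((a' div m + e') div t)"
    and 2: "(a div m + e) mod t = (a' div m + e') mod t"
  shows "a = a' \<and> e = e'"
proof -
  define w where "w = (a div m + e) div t"
  define w' where "w' = (a' div m + e') div t"
  have eq: "a + m * w = a' + m * w'" using 1 by (simp add: w_def w'_def)
  have "(a + m * w) mod m = a mod m" "(a' + m * w') mod m = a' mod m" by simp_all
  then have r: "a mod m = a' mod m" using eq by simp
  have "(a + m * w) div m = a div m + w" "(a' + m * w') div m = a' div m + w'" using m by simp_all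
  then have d: "a div m + w = a' div m + w'" using eq by simp
  have "a div m + e = t * w + (a div m + e) mod t" by (simp add: w_def)
  moreover have "a' div m + e' = t * w' + (a' div m + e') mod t" by (simp add: w'_def)
  ultimately have f: "(t + 1) * w - e = (t + 1) * w' - e'" using d 2 by (simp add: algebra_simps)
  then have "(t + 1) * (w - w') = e - e'" by (simp add: algebra_simps)
  moreover have "\<bar>e - e'\<bar> < t + 1" using e by linarith
  ultimately have "(t + 1) * \<bar>w - w'\<bar> < (t + 1) * 1" using t by (metis abs_mult abs_of_pos add_pos_pos mult.right_neutral zero_less_one)
  then have "\<bar>w - w'\<bar> < 1" using t by (simp only: mult_less_cancel_left_pos[of "t+1"])
  then have ww: "w = w'" by linarith
  then have ee: "e = e'" using f by simp
  have "a div m = a' div m" using d ww by simp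
  then have "a = a'" using r by (metis div_mult_mod_eq)
  with ee show ?thesis by simp
qed

text \<open>Translating each point of the box of side \<open>N t\<close> by about \<open>1/t\<close> times a representative of its class
  modulo the kernel stretches the quotient \<open>\<int>\<^sup>J\<close> by \<open>(t + 1)/t\<close>; the digits \<open>e\<close> fill the gaps.\<close>

lemma res_im_card_le:
  fixes M :: "'i \<Rightarrow> 'i \<Rightarrow> int"
  assumes pv: "pivoted I J m M" and t: "t > 0"
  defines "K \<equiv> m + (\<Sum>p\<in>I. \<Sum>i\<in>I. \<bar>M p i\<bar>) + 2"
  assumes N: "N > 0"
  shows "card (res_im I M N ` zbox I 0 (N * t)) * nat (t + 1) ^ card J \<le>
    card (res_im I M N ` zbox I (- K) (N * (t + 1) + K)) * nat t ^ card J"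
proof -
  let ?A = "zbox I 0 (N * t)" and ?B = "zbox I (- K) (N * (t + 1) + K)"
  define X where "X = inv_into ?A (res_im I M N)"
  \<comment> \<open>\<open>X0\<close> depends on the class modulo the kernel alone and not on the
    residues modulo \<open>N\<close>. Points with the same image and the same digits are therefore
    translated by the same vector.\<close>
  define X0 where "X0 = inv_into ?A (mat_vec I M)"
  define w where "w = (\<lambda>(y :: 'i \<Rightarrow> int) e i. (y i div m + e i) div t :: int)"
  define q where "q = (\<lambda>(y :: 'i \<Rightarrow> int) e i. w y e i + m * (X0 y i div (m * t)) - mat_vec I M (\<lambda>i. X0 y i div (m * t)) i)"
  \<comment> \<open>The second component keeps the remainders of the roundings. They take
    \<open>t\<close> values for each coordinate of \<open>J\<close>, against \<open>t + 1\<close>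
    digits, and this gives the ratio of the powers.\<close>
  define \<phi> where "\<phi> = (\<lambda>(g, e). (res_im I M N (X g + q (snd g) e), (\<lambda>i. (snd g i div m + e i) mod t)))"
  have m: "m > 0" and fI: "finite I" and JI: "J \<subseteq> I" using pv by (simp_all add: pivoted_def)
  then have fJ: "finite J" using finite_subset by blast
  have X: "X g \<in> ?A" "res_im I M N (X g) = g" if "g \<in> res_im I M N ` ?A" for g
    using inv_into_into[OF that] f_inv_into_f[OF that] by (simp_all add: X_def)
  have sg: "snd g = mat_vec I M (X g)" if "g \<in> res_im I M N ` ?A" for g
    using X(2)[OF that] by (simp add: res_im_def prod_eq_iff)
  have X0: "X0 (snd g) \<in> ?A" "mat_vec I M (X0 (snd g)) = snd g" if "g \<in> res_im I M N ` ?A" for g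
  proof -
    have "snd g \<in> mat_vec I M ` ?A" unfolding sg[OF that] using X(1)[OF that] by (rule imageI)
    then show "X0 (snd g) \<in> ?A" "mat_vec I M (X0 (snd g)) = snd g"
      using inv_into_into[of "snd g"] f_inv_into_f[of "snd g" "mat_vec I M" ?A] by (simp_all add: X0_def)
  qed
  have off: "snd g i = 0" if "g \<in> res_im I M N ` ?A" "i \<notin> J" for g i
    unfolding sg[OF that(1)] by (rule pivoted_mat_vec_outside[OF pv that(2)])
  have Pq: "mat_vec I M (q (snd g) e) = (\<lambda>i. m * w (snd g) e i)"
    and qb: "\<bar>t * q (snd g) e i - X0 (snd g) i\<bar> \<le> t * K"
    if g: "g \<in> res_im I M N ` ?A" and e: "e \<in> zbox J 0 (t + 1)" for g e i
    using scaled_point[OF pv t e, of "X0 (snd g)"] unfolding X0(2)[OF g] q_def w_def K_def by simp_all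
  have "inj_on \<phi> (res_im I M N ` ?A \<times> zbox J 0 (t + 1))"
  proof (rule inj_onI)
    fix u v assume u: "u \<in> res_im I M N ` ?A \<times> zbox J 0 (t + 1)"
      and v: "v \<in> res_im I M N ` ?A \<times> zbox J 0 (t + 1)" and uv: "\<phi> u = \<phi> v"
    obtain g e where u': "u = (g, e)" by (cases u)
    obtain g' e' where v': "v = (g', e')" by (cases v)
    have g: "g \<in> res_im I M N ` ?A" and e: "e \<in> zbox J 0 (t + 1)" using u u' by simp_all
    have g': "g' \<in> res_im I M N ` ?A" and e': "e' \<in> zbox J 0 (t + 1)" using v v' by simp_all
    have r: "res_im I M N (X g + q (snd g) e) = res_im I M N (X g' + q (snd g') e')"
      and s: "(\<lambda>i. (snd g i div m + e i) mod t) = (\<lambda>i. (snd g' i div m + e' i) mod t)"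
      using uv by (simp_all add: u' v' \<phi>_def)
    have "mat_vec I M (X g + q (snd g) e) = mat_vec I M (X g' + q (snd g') e')"
      using r by (simp add: res_im_def)
    then have P: "snd g i + m * w (snd g) e i = snd g' i + m * w (snd g') e' i" for i
      unfolding mat_vec_add Pq[OF g e] Pq[OF g' e'] sg[OF g, symmetric] sg[OF g', symmetric]
      by (simp add: fun_eq_iff)
    have "snd g i = snd g' i \<and> e i = e' i" for i
    proof (cases "i \<in> J")
      case True
      show ?thesis
        by (rule shift_inj[OF m t]) (use zboxD(1,2)[OF e True] zboxD(1,2)[OF e' True] P[of i] fun_cong[OF s, of i] in \<open>simp_all add: w_def\<close>)
    next
      case False
      then show ?thesis using off[OF g] off[OF g'] zboxD(3)[OF e] zboxD(3)[OF e'] by simp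
    qed
    then have ge: "snd g = snd g'" "e = e'" by (simp_all add: fun_eq_iff)
    have "fst g = fst g'"
    proof
      fix i
      have "(X g i + q (snd g) e i) mod N = (X g' i + q (snd g) e i) mod N"
        using r unfolding ge res_im_def by (simp add: fun_eq_iff)
      then have "X g i mod N = X g' i mod N" by (simp add: mod_eq_dvd_iff)
      moreover have "fst g i = X g i mod N" "fst g' i = X g' i mod N"
        using arg_cong[OF X(2)[OF g], of fst] arg_cong[OF X(2)[OF g'], of fst]
        by (simp_all add: res_im_def fun_eq_iff)
      ultimately show "fst g i = fst g' i" by simp
    qed
    then show "u = v" using ge by (simp add: u' v' prod_eq_iff)
  qed
  moreover have "\<phi> ` (res_im I M N ` ?A \<times> zbox J 0 (t + 1)) \<subseteq> res_im I M N ` ?B \<times> zbox J 0 t"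
  proof (rule image_subsetI)
    fix u assume u: "u \<in> res_im I M N ` ?A \<times> zbox J 0 (t + 1)"
    obtain g e where u': "u = (g, e)" by (cases u)
    have g: "g \<in> res_im I M N ` ?A" and e: "e \<in> zbox J 0 (t + 1)" using u u' by simp_all
    have "X g + q (snd g) e \<in> ?B"
    \<comment> \<open>The translation is within \<open>K\<close> of \<open>1/t\<close> times a point
      of the box of side \<open>N * t\<close>, so the side grows by \<open>N\<close>, with a border
      of width \<open>K\<close>.\<close>
    proof (rule zboxI)
      fix i assume i: "i \<in> I"
      have 0: "0 \<le> X0 (snd g) i" "X0 (snd g) i < N * t" using zboxD(1,2)[OF X0(1)[OF g] i] by simp_all
      have 1: "0 \<le> X g i" "X g i < N * t" using zboxD(1,2)[OF X(1)[OF g] i] by simp_all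
      have b: "- (t * K) \<le> t * q (snd g) e i - X0 (snd g) i" "t * q (snd g) e i - X0 (snd g) i \<le> t * K"
        using qb[OF g e, of i] by linarith+
      have "t * (- K) \<le> t * q (snd g) e i" using 0 b by simp
      then have "- K \<le> q (snd g) e i" using t by (simp only: mult_le_cancel_left_pos)
      then show "- K \<le> (X g + q (snd g) e) i" using 1 by simp
      have "t * q (snd g) e i < t * (N + K)" using 0 b by (simp add: algebra_simps)
      then have "q (snd g) e i < N + K" using t by (simp only: mult_less_cancel_left_pos)
      then show "(X g + q (snd g) e) i < N * (t + 1) + K" using 1 by (simp add: algebra_simps)
    next
      fix i assume i: "i \<notin> I"
      then have iJ: "i \<notin> J" using JI by blast
      show "(X g + q (snd g) e) i = 0"
        using zboxD(3)[OF X(1)[OF g] i] zboxD(3)[OF X0(1)[OF g] i] off[OF g iJ] zboxD(3)[OF e iJ]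
          pivoted_mat_vec_outside[OF pv iJ] by (simp add: q_def w_def)
    qed
    moreover have "(\<lambda>i. (snd g i div m + e i) mod t) \<in> zbox J 0 t"
      by (rule zboxI) (use t off[OF g] zboxD(3)[OF e] in simp_all)
    ultimately show "\<phi> u \<in> res_im I M N ` ?B \<times> zbox J 0 t"
      by (simp add: u' \<phi>_def)
  qed
  ultimately have "card (res_im I M N ` ?A \<times> zbox J 0 (t + 1)) \<le> card (res_im I M N ` ?B \<times> zbox J 0 t)"
    by (rule card_inj_on_le) (simp add: fI fJ finite_zbox)
  then show ?thesis
    by (simp add: card_cartesian_product card_zbox fJ)
qed

section \<open>Growth of the number of classes modulo a saturated subgroup\<close>

text \<open>After division by \<open>N ^ n\<close> the error is
  \<open>g * ((T + K / N) ^ n - T ^ n)\<close>, which tends to 0.\<close>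

lemma le_of_perturbed_powers:
  fixes a b g T K :: real and n :: nat
  assumes T: "T > 0" and le: "\<And>N :: nat. N > 0 \<Longrightarrow>
    real N ^ n * a \<le> real N ^ n * b + g * ((real N * T + K) ^ n - (real N * T) ^ n)"
  shows "a \<le> b"
proof (rule tendsto_lowerbound)
  show "((\<lambda>N. b + g * ((T + K * inverse (real N)) ^ n - T ^ n)) \<longlongrightarrow> b) sequentially"
    by (rule tendsto_eq_intros lim_inverse_n refl | simp)+
  show "\<forall>\<^sub>F N in sequentially. a \<le> b + g * ((T + K * inverse (real N)) ^ n - T ^ n)"
    using eventually_gt_at_top[of 0]
  proof eventually_elim
    case (elim N)
    have "(real N * T + K) ^ n = real N ^ n * (T + K * inverse (real N)) ^ n"
      using elim by (simp add: power_mult_distrib[symmetric] field_simps)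
    then have "real N ^ n * a \<le> real N ^ n * (b + g * ((T + K * inverse (real N)) ^ n - T ^ n))"
      using le[OF elim] by (simp add: algebra_simps)
    then show ?case using elim by simp
  qed
qed simp

text \<open>The estimate \<open>res_im_card_le\<close> has a border whose width does not depend on
  \<open>N\<close>. Its contribution is bounded by \<open>card_res_im_thickened\<close> and
  disappears on dividing by \<open>N ^ card I\<close> and letting \<open>N\<close> tend to
  infinity.\<close>

lemma card_image_zbox_growth:
  assumes pv: "pivoted I J m M" and t: "t > 0"
  shows "card (mat_vec I M ` zbox I 0 t) * nat (t + 1) ^ card J \<le>
    card (mat_vec I M ` zbox I 0 (t + 1)) * nat t ^ card J"
proof -
  define K where "K = m + (\<Sum>p\<in>I. \<Sum>i\<in>I. \<bar>M p i\<bar>) + 2"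
  have fI: "finite I" and m: "m > 0" using pv by (simp_all add: pivoted_def)
  have K: "K \<ge> 0" unfolding K_def using m by (simp add: sum_nonneg add_nonneg_nonneg)
  let ?a = "card (mat_vec I M ` zbox I 0 t)" and ?b = "card (mat_vec I M ` zbox I 0 (t + 1))"
  let ?n = "card I" and ?d = "card J"
  have "real (?a * nat (t + 1) ^ ?d) \<le> real (?b * nat t ^ ?d)"
  proof (rule le_of_perturbed_powers[where T = "real_of_int (t + 1)" and K = "real_of_int (2 * K)"
        and g = "real (nat t ^ ?d)" and n = "?n"])
    fix N :: nat assume N: "N > 0"
    then have iN: "int N > 0" by simp
    let ?R = "card (res_im I M (int N) ` zbox I (- K) (int N * (t + 1) + K))"
    have "N ^ ?n * ?a * nat (t + 1) ^ ?d \<le> ?R * nat t ^ ?d"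
      using res_im_card_le[OF pv t iN] unfolding card_res_im_zbox[OF fI iN t] K_def[symmetric] by simp
    then have 1: "real (N ^ ?n * ?a * nat (t + 1) ^ ?d) \<le> real (?R * nat t ^ ?d)"
      by (rule of_nat_mono)
    have "?R + nat (int N * (t + 1)) ^ ?n \<le> N ^ ?n * ?b + nat (int N * (t + 1) + 2 * K) ^ ?n"
      using card_res_im_thickened[OF fI iN _ K, of "t + 1" M] t by simp
    then have "real (?R + nat (int N * (t + 1)) ^ ?n) \<le> real (N ^ ?n * ?b + nat (int N * (t + 1) + 2 * K) ^ ?n)"
      by (rule of_nat_mono)
    then have 2: "real ?R + real (nat (int N * (t + 1))) ^ ?n \<le>
        real N ^ ?n * real ?b + real (nat (int N * (t + 1) + 2 * K)) ^ ?n"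
      unfolding of_nat_add of_nat_mult of_nat_power .
    have nn: "0 \<le> int N * (t + 1)" "0 \<le> int N * (t + 1) + 2 * K"
      using t K by (simp_all add: add_nonneg_nonneg)
    have 3: "real (nat (int N * (t + 1))) = real N * real_of_int (t + 1)"
      "real (nat (int N * (t + 1) + 2 * K)) = real N * real_of_int (t + 1) + real_of_int (2 * K)"
      unfolding of_nat_nat[OF nn(1)] of_nat_nat[OF nn(2)] of_int_add[of "int N * (t + 1)"]
        of_int_mult[of "int N"] of_int_of_nat_eq by (rule refl)+
    from 2 have "real ?R \<le> real N ^ ?n * real ?b +
        ((real N * real_of_int (t + 1) + real_of_int (2 * K)) ^ ?n - (real N * real_of_int (t + 1)) ^ ?n)"
      unfolding 3 by linarith
    then have "real ?R * real (nat t ^ ?d) \<le> (real N ^ ?n * real ?b +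
        ((real N * real_of_int (t + 1) + real_of_int (2 * K)) ^ ?n - (real N * real_of_int (t + 1)) ^ ?n)) * real (nat t ^ ?d)"
      by (rule mult_right_mono) simp
    with 1 show "real N ^ ?n * real (?a * nat (t + 1) ^ ?d) \<le> real N ^ ?n * real (?b * nat t ^ ?d) +
        real (nat t ^ ?d) * ((real N * real_of_int (t + 1) + real_of_int (2 * K)) ^ ?n - (real N * real_of_int (t + 1)) ^ ?n)"
      by (simp only: of_nat_mult of_nat_power algebra_simps)
  qed (use t in simp)
  then show ?thesis by (simp only: of_nat_le_iff)
qed

subsection \<open>Successive minima of a hyperplane section\<close>

lemma mat_vec_sum:
  "mat_vec I M (\<lambda>i. \<Sum>k\<in>K. c k * x k i) p = (\<Sum>k\<in>K. c k * mat_vec I M (x k) p)"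
proof -
  have "mat_vec I M (\<lambda>i. \<Sum>k\<in>K. c k * x k i) p = (\<Sum>i\<in>I. \<Sum>k\<in>K. c k * (M p i * x k i))"
    by (simp add: mat_vec_def sum_distrib_left mult.left_commute)
  also have "\<dots> = (\<Sum>k\<in>K. c k * mat_vec I M (x k) p)"
    by (subst sum.swap) (simp add: mat_vec_def sum_distrib_left)
  finally show ?thesis .
qed

lemma card_image_eq_of_fibres:
  assumes "\<And>x y. x \<in> A \<Longrightarrow> y \<in> A \<Longrightarrow> f x = f y \<longleftrightarrow> g x = g y"
  shows "card (f ` A) = card (g ` A)"
proof (rule bij_betw_same_card)
  show "bij_betw (\<lambda>u. g (inv_into A f u)) (f ` A) (g ` A)"
  proof (rule bij_betw_imageI)
    have *: "inv_into A f u \<in> A" "f (inv_into A f u) = u" if "u \<in> f ` A" for u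
      using that by (auto intro: inv_into_into f_inv_into_f)
    show "inj_on (\<lambda>u. g (inv_into A f u)) (f ` A)"
      by (rule inj_onI) (metis * assms)
    have "g (inv_into A f (f x)) = g x" if "x \<in> A" for x
      using *[of "f x"] assms that by blast
    then show "(\<lambda>u. g (inv_into A f u)) ` f ` A = g ` A"
      by (simp add: image_image)
  qed
qed

definition int_independent :: "nat \<Rightarrow> (nat \<Rightarrow> 'i \<Rightarrow> int) \<Rightarrow> bool"
  where "int_independent r x \<longleftrightarrow>
    (\<forall>c. (\<forall>i. (\<Sum>k=1..r. c k * x k i) = 0) \<longrightarrow> (\<forall>k\<in>{1..r}. c k = 0))"

text \<open>The vectors \<open>x\<^sub>1, \<dots>, x\<^sub>r\<close> realise the successive minima below \<open>t\<close> of the lattice orthogonal to \<open>A\<close>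
  and \<open>\<nu> k\<close> bounds the sup norm of \<open>x\<^sub>k\<close>; the kernel of \<open>M\<close> is the saturation of their span. The last
  clause is the form of Minkowski's second theorem that survives the step from \<open>t\<close> to \<open>t + 1\<close>.\<close>

definition flag :: "'i set \<Rightarrow> ('i \<Rightarrow> int) \<Rightarrow> int \<Rightarrow> 'i set \<Rightarrow> int \<Rightarrow> ('i \<Rightarrow> 'i \<Rightarrow> int) \<Rightarrow> nat \<Rightarrow>
    (nat \<Rightarrow> 'i \<Rightarrow> int) \<Rightarrow> (nat \<Rightarrow> int) \<Rightarrow> bool"
  where "flag I A t J m M r x \<nu> \<longleftrightarrow> pivoted I J m M \<and>
    (\<forall>z. (\<forall>p. mat_vec I M z p = 0) \<longrightarrow> (\<Sum>i\<in>I. A i * z i) = 0) \<and>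
    (\<forall>k\<in>{1..r}. (\<forall>i. i \<notin> I \<longrightarrow> x k i = 0) \<and> (\<forall>i. \<bar>x k i\<bar> \<le> \<nu> k) \<and>
      (\<Sum>i\<in>I. A i * x k i) = 0 \<and> (\<forall>p. mat_vec I M (x k) p = 0)) \<and>
    int_independent r x \<and> r + card J = card I \<and>
    (\<Prod>k=1..r. \<nu> k) * t ^ card J \<le> int (card ((\<lambda>z. \<Sum>i\<in>I. A i * z i) ` zbox I 0 t))"

text \<open>Says that no successive minimum up to \<open>b\<close> is still missing from the
  subgroup that \<open>M\<close> describes.\<close>

definition kills :: "'i set \<Rightarrow> ('i \<Rightarrow> int) \<Rightarrow> int \<Rightarrow> ('i \<Rightarrow> 'i \<Rightarrow> int) \<Rightarrow> bool"
  where "kills I A b M \<longleftrightarrow> (\<forall>z. (\<forall>i. i \<notin> I \<longrightarrow> z i = 0) \<longrightarrow> (\<forall>i. \<bar>z i\<bar> \<le> b) \<longrightarrow>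
    (\<Sum>i\<in>I. A i * z i) = 0 \<longrightarrow> (\<forall>p. mat_vec I M z p = 0))"

text \<open>Gaussian elimination of the coordinate \<open>j\<close> by means of the new vector \<open>u\<close>.\<close>

lemma flag_extend:
  fixes M :: "'i \<Rightarrow> 'i \<Rightarrow> int"
  assumes fl: "flag I A t J m M r x \<nu>" and t: "t > 0"
    and u: "\<And>i. i \<notin> I \<Longrightarrow> u i = 0" "\<And>i. \<bar>u i\<bar> \<le> t" "(\<Sum>i\<in>I. A i * u i) = 0"
    and j: "mat_vec I M u j > 0"
  defines "M' \<equiv> \<lambda>p i. mat_vec I M u j * M p i - mat_vec I M u p * M j i"
  shows "flag I A t (J - {j}) (mat_vec I M u j * m) M' (Suc r) (x(Suc r := u)) (\<nu>(Suc r := t))"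
    and "\<And>z. (\<forall>p. mat_vec I M z p = 0) \<Longrightarrow> (\<forall>p. mat_vec I M' z p = 0)"
    and "j \<in> J"
proof -
  let ?c = "mat_vec I M u j"
  have pv: "pivoted I J m M"
    and ker: "\<And>z. (\<forall>p. mat_vec I M z p = 0) \<Longrightarrow> (\<Sum>i\<in>I. A i * z i) = 0"
    and x: "\<And>k. k \<in> {1..r} \<Longrightarrow> (\<forall>i. i \<notin> I \<longrightarrow> x k i = 0) \<and> (\<forall>i. \<bar>x k i\<bar> \<le> \<nu> k) \<and>
      (\<Sum>i\<in>I. A i * x k i) = 0 \<and> (\<forall>p. mat_vec I M (x k) p = 0)"
    and ind: "int_independent r x" and r: "r + card J = card I"
    and bd: "(\<Prod>k=1..r. \<nu> k) * t ^ card J \<le> int (card ((\<lambda>z. \<Sum>i\<in>I. A i * z i) ` zbox I 0 t))"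
    using fl unfolding flag_def by simp_all
  show jJ: "j \<in> J" using pivoted_mat_vec_outside[OF pv, of j u] j by (cases "j \<in> J") simp_all
  have fJ: "finite J" using pv finite_subset by (auto simp: pivoted_def)
  have cJ: "card J = Suc (card (J - {j}))" using jJ fJ by (metis card_Suc_Diff1)
  have M': "mat_vec I M' z p = ?c * mat_vec I M z p - mat_vec I M z j * mat_vec I M u p" for z p
    unfolding M'_def mat_vec_def[of I _ z] sum_distrib_left sum_distrib_right sum_subtractf[symmetric]
    by (rule sum.cong) (simp_all add: algebra_simps)
  show k': "\<forall>p. mat_vec I M' z p = 0" if "\<forall>p. mat_vec I M z p = 0" for z
    using that by (simp add: M')
  have pv': "pivoted I (J - {j}) (?c * m) M'"
  proof -
    have "M' p i = 0" if "p \<notin> J - {j}" for p i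
    proof (cases "p = j")
      case False
      with that have "p \<notin> J" by simp
      then show ?thesis using pivoted_mat_vec_outside[OF pv, of p u] pv by (simp add: M'_def pivoted_def)
    qed (simp add: M'_def)
    moreover have "M' p i = (if p = i then ?c * m else 0)" if "p \<in> J - {j}" "i \<in> J - {j}" for p i
    proof -
      have "M p i = (if p = i then m else 0)" "M j i = 0" using pv that jJ by (auto simp: pivoted_def)
      then show ?thesis by (simp add: M'_def)
    qed
    ultimately show ?thesis using pv j by (auto simp: pivoted_def)
  qed
  have ker': "(\<Sum>i\<in>I. A i * z i) = 0" if "\<forall>p. mat_vec I M' z p = 0" for z
  proof -
    \<comment> \<open>The combination lies in the kernel of \<open>M\<close> because
      \<open>z\<close> lies in that of \<open>M'\<close>. As \<open>u\<close> is orthogonal to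
      \<open>A\<close> and the factor of \<open>z\<close> is positive, \<open>z\<close> is
      orthogonal to \<open>A\<close> as well.\<close>
    have "mat_vec I M (\<lambda>i. ?c * z i + (- mat_vec I M z j * u i)) p = 0" for p
      unfolding mat_vec_lin mat_vec_scale using that by (simp add: M')
    then have "(\<Sum>i\<in>I. A i * (?c * z i + (- mat_vec I M z j * u i))) = 0"
      by (intro ker allI)
    moreover have "(\<Sum>i\<in>I. A i * (?c * z i + (- mat_vec I M z j * u i))) =
        ?c * (\<Sum>i\<in>I. A i * z i) - mat_vec I M z j * (\<Sum>i\<in>I. A i * u i)"
      by (simp add: algebra_simps sum_subtractf sum_distrib_left)
    ultimately show ?thesis using u(3) j by simp
  qed
  have x': "(\<forall>i. i \<notin> I \<longrightarrow> (x(Suc r := u)) k i = 0) \<and> (\<forall>i. \<bar>(x(Suc r := u)) k i\<bar> \<le> (\<nu>(Suc r := t)) k) \<and>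
      (\<Sum>i\<in>I. A i * (x(Suc r := u)) k i) = 0 \<and> (\<forall>p. mat_vec I M' ((x(Suc r := u)) k) p = 0)"
    if "k \<in> {1..Suc r}" for k
  proof (cases "k = Suc r")
    case True
    then show ?thesis using u by (simp add: M')
  next
    case False
    then have "k \<in> {1..r}" using that by simp
    from x[OF this] show ?thesis using False k'[of "x k"] by simp
  qed
  have ind': "int_independent (Suc r) (x(Suc r := u))"
    unfolding int_independent_def
  proof (rule allI, rule impI)
    fix c assume c: "\<forall>i. (\<Sum>k=1..Suc r. c k * (x(Suc r := u)) k i) = 0"
    have c': "c (Suc r) * u i + (\<Sum>k=1..r. c k * x k i) = 0" for i
    proof -
      have "(\<Sum>k=1..r. c k * (x(Suc r := u)) k i) = (\<Sum>k=1..r. c k * x k i)"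
        by (rule sum.cong) auto
      then show ?thesis using c[rule_format, of i] by simp
    qed
    \<comment> \<open>At the coordinate \<open>j\<close> the images of the old vectors vanish and
      that of \<open>u\<close> does not, which isolates the coefficient of \<open>u\<close>.\<close>
    have "mat_vec I M (\<lambda>i. c (Suc r) * u i + (\<Sum>k=1..r. c k * x k i)) j = 0"
      unfolding c' by (simp add: mat_vec_def)
    then have "c (Suc r) * ?c + (\<Sum>k=1..r. c k * mat_vec I M (x k) j) = 0"
      by (simp only: mat_vec_lin mat_vec_sum)
    moreover have "(\<Sum>k=1..r. c k * mat_vec I M (x k) j) = 0"
      by (rule sum.neutral) (use x in simp)
    ultimately have 0: "c (Suc r) = 0" using j by simp
    then have "\<forall>i. (\<Sum>k=1..r. c k * x k i) = 0" using c' by simp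
    then have "\<forall>k\<in>{1..r}. c k = 0" using ind unfolding int_independent_def by blast
    with 0 show "\<forall>k\<in>{1..Suc r}. c k = 0" by (auto simp: le_Suc_eq)
  qed
  have "(\<Prod>k=1..Suc r. (\<nu>(Suc r := t)) k) = (\<Prod>k=1..r. \<nu> k) * t"
    by simp
  \<comment> \<open>The new factor \<open>t\<close> replaces the power of \<open>t\<close> lost with
    the pivot \<open>j\<close>, so the left side keeps its value.\<close>
  then have bd': "(\<Prod>k=1..Suc r. (\<nu>(Suc r := t)) k) * t ^ card (J - {j}) \<le>
      int (card ((\<lambda>z. \<Sum>i\<in>I. A i * z i) ` zbox I 0 t))"
    using bd unfolding cJ by (simp add: mult.assoc)
  show "flag I A t (J - {j}) (?c * m) M' (Suc r) (x(Suc r := u)) (\<nu>(Suc r := t))"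
    unfolding flag_def
    by (intro conjI allI impI ballI pv' ker' ind' bd' x'[THEN conjunct1, rule_format]
        x'[THEN conjunct2, THEN conjunct1, rule_format] x'[THEN conjunct2, THEN conjunct2, THEN conjunct1]
        x'[THEN conjunct2, THEN conjunct2, THEN conjunct2, rule_format]) (use r cJ in auto)
qed

section \<open>Collecting the minima as the side grows\<close>

text \<open>A vector that is not yet killed has norm exactly \<open>t\<close> and becomes a new
  minimum at the price of one pivot, so the process ends. The side stays fixed meanwhile, which
  allows for several equal minima.\<close>

lemma flag_maximal:
  assumes "flag I A t J m M r x \<nu>" "t > 0" "kills I A (t - 1) M"
  shows "\<exists>J m M r x \<nu>. flag I A t J m M r x \<nu> \<and> kills I A t M"
  using assms
proof (induction "card J" arbitrary: J m M r x \<nu> rule: less_induct)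
  case less
  show ?case
  proof (cases "kills I A t M")
    case True
    then show ?thesis using less.prems(1) by blast
  next
    case False
    then obtain v j where v: "\<And>i. i \<notin> I \<Longrightarrow> v i = 0" "\<And>i. \<bar>v i\<bar> \<le> t" "(\<Sum>i\<in>I. A i * v i) = 0"
      and vj: "mat_vec I M v j \<noteq> 0"
      unfolding kills_def by blast
    \<comment> \<open>The sign makes the entry at \<open>j\<close> positive, as
      \<open>flag_extend\<close> requires.\<close>
    define u where "u = (\<lambda>i. sgn (mat_vec I M v j) * v i)"
    have u: "\<And>i. i \<notin> I \<Longrightarrow> u i = 0" "\<And>i. \<bar>u i\<bar> \<le> t" "(\<Sum>i\<in>I. A i * u i) = 0"
      using v vj by (simp_all add: u_def abs_mult abs_sgn_eq mult.left_commute[of "A _"] flip: sum_distrib_left)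
    have uj: "mat_vec I M u j > 0"
      unfolding u_def mat_vec_scale using vj by (simp add: sgn_if)
    let ?M = "\<lambda>p i. mat_vec I M u j * M p i - mat_vec I M u p * M j i"
    note ex = flag_extend[OF less.prems(1,2) u uj]
    have "kills I A (t - 1) ?M"
      using less.prems(3) ex(2) unfolding kills_def by blast
    moreover have "card (J - {j}) < card J"
    proof -
      have "finite J" using less.prems(1) finite_subset by (auto simp: flag_def pivoted_def)
      then show ?thesis using ex(3) by (rule card_Diff1_less)
    qed
    ultimately show ?thesis using less.hyps ex(1) less.prems(2) by blast
  qed
qed

text \<open>Coordinates of two points of a box of side \<open>s\<close> differ by at most
  \<open>s - 1\<close>. So equal values of the form give a difference killed by \<open>M\<close>;
  conversely the kernel of \<open>M\<close> is orthogonal to \<open>A\<close>.\<close>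

lemma kills_card_eq:
  assumes fl: "flag I A t J m M r x \<nu>" and k: "kills I A (s - 1) M"
  shows "card (mat_vec I M ` zbox I 0 s) = card ((\<lambda>z. \<Sum>i\<in>I. A i * z i) ` zbox I 0 s)"
proof (rule card_image_eq_of_fibres)
  fix y z assume y: "y \<in> zbox I 0 s" and z: "z \<in> zbox I 0 s"
  have out: "(y - z) i = 0" if "i \<notin> I" for i using zboxD(3)[OF y that] zboxD(3)[OF z that] by simp
  have sd: "(\<Sum>i\<in>I. A i * (y - z) i) = (\<Sum>i\<in>I. A i * y i) - (\<Sum>i\<in>I. A i * z i)"
    by (simp add: right_diff_distrib sum_subtractf)
  have md: "mat_vec I M (y - z) p = mat_vec I M y p - mat_vec I M z p" for p
    by (simp add: mat_vec_diff)
  show "mat_vec I M y = mat_vec I M z \<longleftrightarrow> (\<Sum>i\<in>I. A i * y i) = (\<Sum>i\<in>I. A i * z i)"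
  proof
    assume "mat_vec I M y = mat_vec I M z"
    then have "\<forall>p. mat_vec I M (y - z) p = 0" by (simp add: md)
    then have "(\<Sum>i\<in>I. A i * (y - z) i) = 0" using fl unfolding flag_def by blast
    then show "(\<Sum>i\<in>I. A i * y i) = (\<Sum>i\<in>I. A i * z i)" unfolding sd by simp
  next
    assume "(\<Sum>i\<in>I. A i * y i) = (\<Sum>i\<in>I. A i * z i)"
    then have 0: "(\<Sum>i\<in>I. A i * (y - z) i) = 0" unfolding sd by simp
    show "mat_vec I M y = mat_vec I M z"
    \<comment> \<open>The bound \<open>s - 1\<close> must be non-negative, since it is also asked of
      the coordinates outside \<open>I\<close>. A point of \<open>I\<close> supplies
      \<open>s > 0\<close>.\<close>
    proof (cases "I = {}")
      case True
      then show ?thesis by (simp add: mat_vec_def)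
    next
      case False
      then obtain i0 where "i0 \<in> I" by blast
      then have s: "s > 0" using zboxD(1,2)[OF y, of i0] by linarith
      have "\<bar>(y - z) i\<bar> \<le> s - 1" for i
        using zboxD[OF y, of i] zboxD[OF z, of i] s by (cases "i \<in> I") auto
      then have "\<forall>p. mat_vec I M (y - z) p = 0"
        using k out 0 unfolding kills_def by blast
      then show ?thesis by (simp add: md fun_eq_iff)
    qed
  qed
qed

text \<open>On both boxes the values of the form are as many as the classes modulo the kernel of
  \<open>M\<close>. Their number grows at least by the factor \<open>((t + 1) / t) ^ card J\<close>,
  which is the growth of the left side of the inequality in \<open>flag\<close>.\<close>

lemma flag_step:
  assumes fl: "flag I A t J m M r x \<nu>" and t: "t > 0" and k: "kills I A t M"
  shows "flag I A (t + 1) J m M r x \<nu>"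
proof -
  have k': "kills I A (t - 1) M" using k unfolding kills_def by (meson order_trans zle_diff1_eq less_imp_le order_refl)
  let ?a = "card (mat_vec I M ` zbox I 0 t)" and ?b = "card (mat_vec I M ` zbox I 0 (t + 1))"
  let ?\<nu> = "\<Prod>k=1..r. \<nu> k" and ?d = "card J"
  have pv: "pivoted I J m M" using fl by (simp add: flag_def)
  have bd: "?\<nu> * t ^ ?d \<le> int ?a"
    using fl unfolding kills_card_eq[OF fl k'] flag_def by simp
  have "int ?a * (t + 1) ^ ?d \<le> int ?b * t ^ ?d"
  proof -
    have "int (?a * nat (t + 1) ^ ?d) \<le> int (?b * nat t ^ ?d)"
      using card_image_zbox_growth[OF pv t] by (rule of_nat_mono)
    then show ?thesis using t by simp
  qed
  moreover have "?\<nu> * t ^ ?d * (t + 1) ^ ?d \<le> int ?a * (t + 1) ^ ?d"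
    using bd t by (intro mult_right_mono) simp_all
  ultimately have "?\<nu> * (t + 1) ^ ?d * t ^ ?d \<le> int ?b * t ^ ?d"
    by (simp add: mult_ac)
  then have "?\<nu> * (t + 1) ^ ?d \<le> int ?b" using t by simp
  \<comment> \<open>Points of the box of side \<open>t + 1\<close> differ by up to \<open>t\<close>,
    so the killing bound \<open>t\<close> is used in full.\<close>
  also have "?b = card ((\<lambda>z. \<Sum>i\<in>I. A i * z i) ` zbox I 0 (t + 1))"
    by (rule kills_card_eq[OF fl]) (use k in simp)
  finally show ?thesis using fl by (simp add: flag_def)
qed

text \<open>For side 1 the identity matrix serves: no minimum is reached and every coordinate is a
  pivot. Then \<open>flag_maximal\<close> adds the minima of norm equal to the side, and
  \<open>flag_step\<close> enlarges the side by one.\<close>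

lemma flag_exists:
  assumes fI: "finite I"
  shows "\<exists>J m M r x \<nu>. flag I A (int n + 1) J m M r x \<nu> \<and> kills I A (int n) M"
proof (induction n)
  case 0
  let ?M = "\<lambda>p i. if p = i \<and> p \<in> I then 1 else 0 :: int"
  have pv: "pivoted I I 1 ?M" using fI by (auto simp: pivoted_def)
  have M: "mat_vec I ?M z p = (if p \<in> I then z p else 0)" for z p
    using fI by (auto simp: mat_vec_def if_distrib[of "\<lambda>c. c * _"] cong: if_cong)
  have "zbox I 0 (1 :: int) \<noteq> {}"
    using zboxI[of I 0 "\<lambda>_. 0" 1] by force
  then have "card ((\<lambda>z. \<Sum>i\<in>I. A i * z i) ` zbox I 0 1) > 0"
    using fI by (simp add: card_gt_0_iff finite_zbox)
  then have "int (card ((\<lambda>z. \<Sum>i\<in>I. A i * z i) ` zbox I 0 1)) \<ge> 1" by linarith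
  moreover have "(\<Sum>i\<in>I. A i * z i) = 0" if "\<forall>p. mat_vec I ?M z p = 0" for z
    using that by (intro sum.neutral) (auto simp: M split: if_splits)
  ultimately have "flag I A 1 I 1 ?M 0 (\<lambda>_ _. 0) (\<lambda>_. 0)"
    unfolding flag_def int_independent_def using pv by simp
  moreover have "kills I A 0 ?M"
    unfolding kills_def M by simp
  ultimately show ?case by fastforce
next
  case (Suc n)
  then obtain J m M r x \<nu> where "flag I A (int n + 1) J m M r x \<nu>" "kills I A (int n) M" by blast
  then obtain J m M r x \<nu> where "flag I A (int n + 1) J m M r x \<nu>" "kills I A (int n + 1) M"
    using flag_maximal[of I A "int n + 1" J m M r x \<nu>] by auto
  then have "flag I A (int (Suc n) + 1) J m M r x \<nu>" "kills I A (int (Suc n)) M"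
    using flag_step[of I A "int n + 1" J m M r x \<nu>] by (simp_all add: add.commute)
  then show ?case by blast
qed

text \<open>The extreme values come from the negative and from the positive coefficients alone, each
  with the factor \<open>t - 1\<close>. The number of integers between them gives the bound.\<close>

lemma card_image_form_le:
  fixes A :: "'i \<Rightarrow> int"
  assumes fI: "finite I" and t: "t > 0"
  shows "int (card ((\<lambda>z. \<Sum>i\<in>I. A i * z i) ` zbox I 0 t)) \<le> (\<Sum>i\<in>I. \<bar>A i\<bar>) * (t - 1) + 1"
proof -
  define lo where "lo = (\<Sum>i\<in>I. min (A i) 0 * (t - 1))"
  define hi where "hi = (\<Sum>i\<in>I. max (A i) 0 * (t - 1))"
  have "(\<lambda>z. \<Sum>i\<in>I. A i * z i) ` zbox I 0 t \<subseteq> {lo..hi}"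
  proof (rule image_subsetI)
    fix z assume z: "z \<in> zbox I 0 t"
    have b: "min (A i) 0 * (t - 1) \<le> A i * z i" "A i * z i \<le> max (A i) 0 * (t - 1)" if "i \<in> I" for i
    proof -
      have zi: "0 \<le> z i" "z i \<le> t - 1" using zboxD(1,2)[OF z that] by simp_all
      show "min (A i) 0 * (t - 1) \<le> A i * z i"
        using zi mult_left_mono_neg[OF zi(2), of "A i"] by (cases "A i \<ge> 0") simp_all
      show "A i * z i \<le> max (A i) 0 * (t - 1)"
        using zi mult_left_mono[OF zi(2), of "A i"] mult_nonpos_nonneg[of "A i" "z i"] by (cases "A i \<ge> 0") simp_all
    qed
    show "(\<Sum>i\<in>I. A i * z i) \<in> {lo..hi}"
      unfolding lo_def hi_def using b by (simp add: sum_mono)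
  qed
  then have "card ((\<lambda>z. \<Sum>i\<in>I. A i * z i) ` zbox I 0 t) \<le> card {lo..hi}"
    by (intro card_mono) simp_all
  moreover have hl: "hi - lo = (\<Sum>i\<in>I. \<bar>A i\<bar>) * (t - 1)"
    unfolding hi_def lo_def sum_subtractf[symmetric] sum_distrib_right
    by (intro sum.cong refl) (simp add: min_def max_def algebra_simps)
  moreover have "0 \<le> (\<Sum>i\<in>I. \<bar>A i\<bar>) * (t - 1)" using t by (simp add: sum_nonneg)
  ultimately show ?thesis by simp
qed

text \<open>The side is taken as \<open>S + 1\<close> with \<open>S\<close> the l1 norm of
  \<open>A\<close>: vectors of norm at most \<open>S\<close> span a sublattice of full rank in the
  lattice orthogonal to \<open>A\<close>, so exactly one pivot is left.\<close>

lemma small_orthogonal_vectors: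
  fixes A :: "'i \<Rightarrow> int"
  assumes fI: "finite I" and ne: "I \<noteq> {}" and A: "\<And>i. i \<in> I \<Longrightarrow> A i \<noteq> 0"
  obtains x \<nu> where "int_independent (card I - 1) x"
    and "\<And>k i. k \<in> {1..card I - 1} \<Longrightarrow> i \<notin> I \<Longrightarrow> x k i = 0"
    and "\<And>k i. k \<in> {1..card I - 1} \<Longrightarrow> \<bar>x k i\<bar> \<le> \<nu> k"
    and "\<And>k. k \<in> {1..card I - 1} \<Longrightarrow> (\<Sum>i\<in>I. A i * x k i) = 0"
    and "(\<Prod>k=1..card I - 1. \<nu> k) \<le> (\<Sum>i\<in>I. \<bar>A i\<bar>)"
proof -
  define S where "S = (\<Sum>i\<in>I. \<bar>A i\<bar>)"
  have le: "\<bar>A i\<bar> \<le> S" if "i \<in> I" for i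
    unfolding S_def using that fI by (intro member_le_sum) auto
  obtain i0 where i0: "i0 \<in> I" using ne by blast
  have S: "S \<ge> 1" using le[OF i0] A[OF i0] by linarith
  then have nS: "int (nat S) = S" by simp
  obtain J m M r x \<nu> where fl: "flag I A (S + 1) J m M r x \<nu>" and k: "kills I A S M"
    using flag_exists[OF fI, of A "nat S"] unfolding nS by blast
  have pv: "pivoted I J m M" and r: "r + card J = card I" and ind: "int_independent r x"
    and x: "\<And>k. k \<in> {1..r} \<Longrightarrow> (\<forall>i. i \<notin> I \<longrightarrow> x k i = 0) \<and> (\<forall>i. \<bar>x k i\<bar> \<le> \<nu> k) \<and>
      (\<Sum>i\<in>I. A i * x k i) = 0"
    and bd: "(\<Prod>k=1..r. \<nu> k) * (S + 1) ^ card J \<le> int (card ((\<lambda>z. \<Sum>i\<in>I. A i * z i) ` zbox I 0 (S + 1)))"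
    using fl unfolding flag_def by simp_all
  have JI: "J \<subseteq> I" and m: "m > 0" using pv by (simp_all add: pivoted_def)
  have fJ: "finite J" using JI fI by (rule finite_subset)
  have "J \<noteq> {}"
  proof
    \<comment> \<open>Without pivots \<open>M\<close> would annihilate a unit vector, on which the
      form takes the non-zero value \<open>A i0\<close>.\<close>
    assume "J = {}"
    then have "\<forall>p. mat_vec I M (\<lambda>i. if i = i0 then 1 else 0) p = 0"
      using pivoted_mat_vec_outside[OF pv] by simp
    then have "(\<Sum>i\<in>I. A i * (if i = i0 then 1 else 0)) = 0"
      using fl unfolding flag_def by blast
    moreover have "(\<Sum>i\<in>I. A i * (if i = i0 then 1 else 0)) = A i0"
      using fI i0 by (simp add: if_distrib cong: if_cong)
    ultimately show False using A[OF i0] by simp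
  qed
  moreover have "j = k" if "j \<in> J" "k \<in> J" for j k
  proof (rule ccontr)
    assume jk: "j \<noteq> k"
    have jI: "j \<in> I" "k \<in> I" using that JI by blast+
    \<comment> \<open>This vector is orthogonal to \<open>A\<close>, of norm at most
      \<open>S\<close>, and hence killed. But it is supported on \<open>J\<close>, where
      \<open>M\<close> acts as multiplication by \<open>m\<close>.\<close>
    define u where "u = (\<lambda>i. if i = j then A k else if i = k then - A j else 0)"
    have "(\<Sum>i\<in>I. A i * u i) = (\<Sum>i\<in>{j, k}. A i * u i)"
      using fI jI by (intro sum.mono_neutral_right) (auto simp: u_def)
    also have "\<dots> = 0" using jk by (simp add: u_def)
    finally have "(\<Sum>i\<in>I. A i * u i) = 0" .
    moreover have "\<bar>u i\<bar> \<le> S" for i using le jI S by (simp add: u_def)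
    moreover have "u i = 0" if "i \<notin> I" for i using that jI by (auto simp: u_def)
    ultimately have "\<forall>p. mat_vec I M u p = 0" using k unfolding kills_def by blast
    moreover have "mat_vec I M u = (\<lambda>i. m * u i)"
      by (rule pivoted_mat_vec_supported[OF pv]) (use that in \<open>auto simp: u_def\<close>)
    ultimately have "m * u j = 0" by metis
    then show False using m A[OF jI(2)] by (simp add: u_def)
  qed
  ultimately have cJ: "card J = 1"
    by (metis is_singletonI' is_singleton_altdef)
  then have r': "r = card I - 1" using r by simp
  \<comment> \<open>As \<open>S * S + 1 < (S + 1) * (S + 1)\<close>, the integral product is less
    than \<open>S + 1\<close>.\<close>
  have "(\<Prod>k=1..r. \<nu> k) * (S + 1) \<le> S * S + 1"
    using bd card_image_form_le[OF fI, of "S + 1" A] S unfolding cJ S_def[symmetric] by simp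
  then have "(\<Prod>k=1..r. \<nu> k) * (S + 1) < (S + 1) * (S + 1)"
    using S by (simp add: algebra_simps)
  then have "(\<Prod>k=1..r. \<nu> k) \<le> S" using S by simp
  then show ?thesis
    using ind x unfolding r' S_def by (intro that[of x \<nu>]) blast+
qed

subsection \<open>Derivations as integer vectors\<close>

text \<open>Elimination without division: a vector with non-zero entry at \<open>p\<close> clears
  that entry in the others, and induction applies to one coordinate and one vector fewer.\<close>

lemma integer_relation:
  fixes x :: "'k \<Rightarrow> 'i \<Rightarrow> int"
  assumes "finite I" "finite K" "card I < card K"
  obtains c where "\<exists>k\<in>K. c k \<noteq> 0" "\<And>i. i \<in> I \<Longrightarrow> (\<Sum>k\<in>K. c k * x k i) = 0"
proof -
  have "\<exists>c. (\<exists>k\<in>K. c k \<noteq> 0) \<and> (\<forall>i\<in>I. (\<Sum>k\<in>K. c k * x k i) = 0)"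
    using assms
  proof (induction I arbitrary: K x rule: finite_induct)
    case empty
    then have "K \<noteq> {}" by auto
    then show ?case by (intro exI[of _ "\<lambda>_. 1"]) auto
  next
    case (insert p I)
    show ?case
    proof (cases "\<exists>k0\<in>K. x k0 p \<noteq> 0")
      case False
      have "card I < card K" using insert.hyps insert.prems by simp
      then obtain c where "\<exists>k\<in>K. c k \<noteq> 0" "\<forall>i\<in>I. (\<Sum>k\<in>K. c k * x k i) = 0"
        using insert.IH[OF insert.prems(1)] by blast
      then show ?thesis using False by (intro exI[of _ c]) auto
    next
      case True
      then obtain k0 where k0: "k0 \<in> K" "x k0 p \<noteq> 0" by blast
      let ?K = "K - {k0}"
      define y where "y = (\<lambda>k i. x k0 p * x k i - x k p * x k0 i)"
      have "card I < card ?K" using insert.hyps insert.prems k0 by simp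
      then obtain c where c: "\<exists>k\<in>?K. c k \<noteq> 0" "\<forall>i\<in>I. (\<Sum>k\<in>?K. c k * y k i) = 0"
        using insert.IH[of ?K y] insert.prems(1) by auto
      \<comment> \<open>The coefficient of \<open>k0\<close> collects what the elimination
        subtracted. The others are scaled by the pivot \<open>x k0 p\<close>, so a non-zero one
        stays non-zero.\<close>
      define d where "d = (\<lambda>k. if k = k0 then - (\<Sum>k\<in>?K. c k * x k p) else c k * x k0 p)"
      have d: "(\<Sum>k\<in>K. d k * x k i) = (\<Sum>k\<in>?K. c k * y k i)" for i
      proof -
        have "(\<Sum>k\<in>K. d k * x k i) = d k0 * x k0 i + (\<Sum>k\<in>?K. d k * x k i)"
          by (rule sum.remove[OF insert.prems(1) k0(1)])
        also have "(\<Sum>k\<in>?K. d k * x k i) = (\<Sum>k\<in>?K. c k * x k0 p * x k i)"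
          by (rule sum.cong) (auto simp: d_def)
        also have "d k0 * x k0 i = (\<Sum>k\<in>?K. - (c k * x k p * x k0 i))"
          by (simp add: d_def sum_distrib_right sum_negf)
        also have "(\<Sum>k\<in>?K. - (c k * x k p * x k0 i)) + (\<Sum>k\<in>?K. c k * x k0 p * x k i) = (\<Sum>k\<in>?K. c k * y k i)"
          unfolding sum.distrib[symmetric] by (rule sum.cong) (simp_all add: y_def algebra_simps)
        finally show ?thesis .
      qed
      have "\<exists>k\<in>K. d k \<noteq> 0"
        using c(1) k0 by (auto simp: d_def)
      moreover have "(\<Sum>k\<in>K. d k * x k i) = 0" if "i \<in> insert p I" for i
      proof (cases "i = p")
        case True
        have "(\<Sum>k\<in>?K. c k * y k p) = 0" by (simp add: y_def)
        then show ?thesis using d True by simp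
      qed (use c(2) d that in simp)
      ultimately show ?thesis by blast
    qed
  qed
  then show ?thesis using that by blast
qed

section \<open>Coefficients of \<open>abs_d\<close> and their size\<close>

definition abs_d_coeff :: "int \<Rightarrow> prime_nat \<Rightarrow> int"
  where "abs_d_coeff n p = (n * int (multiplicity (int_of_prime p) n)) div int_of_prime p"

lemma prime_int_of_prime: "prime (int_of_prime p)"
  using nat_of_prime[of p] by simp

lemma abs_d_coeff_eq_0: "p \<notin> int_supp n \<Longrightarrow> abs_d_coeff n p = 0"
  by (simp add: abs_d_coeff_def int_supp_def not_dvd_imp_multiplicity_0)

text \<open>The division is exact on the support of \<open>n\<close>, and off it both sides vanish.
  Estimates can thus avoid \<open>div\<close>.\<close>

lemma int_of_prime_times_abs_d_coeff:
  "int_of_prime p * abs_d_coeff n p = n * int (multiplicity (int_of_prime p) n)"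
proof (cases "p \<in> int_supp n")
  case True
  then show ?thesis by (simp add: abs_d_coeff_def int_supp_def)
next
  case False
  then show ?thesis by (simp add: abs_d_coeff_eq_0) (simp add: int_supp_def not_dvd_imp_multiplicity_0)
qed

lemma abs_d_coeff_nonneg: "n > 0 \<Longrightarrow> abs_d_coeff n p \<ge> 0"
  using prime_gt_0_int[OF prime_int_of_prime[of p]]
  by (simp add: abs_d_coeff_def pos_imp_zdiv_nonneg_iff)

lemma abs_d_coeff_pos:
  assumes "n > 0" "p \<in> int_supp n"
  shows "abs_d_coeff n p > 0"
proof -
  have "multiplicity (int_of_prime p) n > 0"
    using assms prime_int_of_prime[of p]
    by (intro prime_multiplicity_gt_zero_iff[THEN iffD2]) (auto simp: int_supp_def prime_imp_prime_elem)
  then have "int_of_prime p * abs_d_coeff n p > 0"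
    unfolding int_of_prime_times_abs_d_coeff using assms by simp
  then show ?thesis by (simp add: zero_less_mult_iff)
qed

text \<open>Carries finiteness and the prime factorization over to sums and products indexed by
  \<open>prime_nat\<close>.\<close>

lemma bij_betw_int_of_prime:
  assumes "n \<noteq> 0"
  shows "bij_betw int_of_prime (int_supp n) (prime_factors n)"
proof (rule bij_betw_imageI)
  show "inj_on int_of_prime (int_supp n)"
    by (rule inj_onI) (simp add: nat_of_prime_inject)
  show "int_of_prime ` int_supp n = prime_factors n"
  proof (rule set_eqI, rule iffI)
    fix q assume "q \<in> int_of_prime ` int_supp n"
    then show "q \<in> prime_factors n"
      using assms prime_int_of_prime by (auto simp: int_supp_def in_prime_factors_iff)
  next
    fix q assume q: "q \<in> prime_factors n"
    then have "prime q" by (rule in_prime_factors_imp_prime)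
    then have "prime (nat q)" "int (nat q) = q" by (simp_all add: prime_ge_0_int)
    then have "int_of_prime (Prime_nat (nat q)) = q" by (simp add: Prime_nat_inverse)
    moreover from this have "Prime_nat (nat q) \<in> int_supp n"
      using q by (simp add: int_supp_def in_prime_factors_iff)
    ultimately show "q \<in> int_of_prime ` int_supp n" by (metis imageI)
  qed
qed

lemma finite_int_supp: "n \<noteq> 0 \<Longrightarrow> finite (int_supp n)"
  using bij_betw_finite[OF bij_betw_int_of_prime] by simp

text \<open>Every prime is at least 2. So a coefficient is at most \<open>n / 2\<close> times the
  multiplicity, and the multiplicities sum to at most \<open>ln n / ln 2\<close>.\<close>

lemma sum_abs_d_coeff_le:
  assumes n: "n > 0"
  shows "real_of_int (\<Sum>p\<in>int_supp n. abs_d_coeff n p) \<le> n * ln n / (2 * ln 2)"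
proof -
  let ?v = "\<lambda>p. multiplicity (int_of_prime p) n"
  have "(\<Prod>p\<in>int_supp n. int_of_prime p ^ ?v p) = (\<Prod>q\<in>prime_factors n. q ^ multiplicity q n)"
    using bij_betw_int_of_prime[of n] n by (intro prod.reindex_bij_betw[where g = "\<lambda>q. q ^ multiplicity q n"]) simp
  also have "\<dots> = n" using n by (subst prod_prime_factors) simp_all
  finally have "real_of_int (\<Prod>p\<in>int_supp n. int_of_prime p ^ ?v p) = real_of_int n"
    by (rule arg_cong)
  then have "(\<Prod>p\<in>int_supp n. real (nat_of_prime p) ^ ?v p) = real_of_int n"
    by (simp only: of_int_prod of_int_power of_int_of_nat_eq)
  then have "ln (real_of_int n) = ln (\<Prod>p\<in>int_supp n. real (nat_of_prime p) ^ ?v p)"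
    by (simp only:)
  also have "\<dots> = (\<Sum>p\<in>int_supp n. ln (real (nat_of_prime p) ^ ?v p))"
    using finite_int_supp[of n] n nat_of_prime prime_gt_0_nat by (intro ln_prod) simp_all
  also have "\<dots> \<ge> (\<Sum>p\<in>int_supp n. real (?v p) * ln 2)"
  proof (rule sum_mono)
    fix p
    have "2 \<le> nat_of_prime p" using nat_of_prime[of p] by (simp add: prime_ge_2_nat)
    then show "real (?v p) * ln 2 \<le> ln (real (nat_of_prime p) ^ ?v p)"
      by (simp add: ln_realpow mult_left_mono)
  qed
  finally have v: "(\<Sum>p\<in>int_supp n. real (?v p)) * ln 2 \<le> ln n"
    by (simp add: sum_distrib_right)
  have "real_of_int (abs_d_coeff n p) \<le> n * real (?v p) / 2" for p
  proof -
    have "2 \<le> int_of_prime p" using prime_ge_2_int[OF prime_int_of_prime] .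
    then have "2 * abs_d_coeff n p \<le> int_of_prime p * abs_d_coeff n p"
      by (intro mult_right_mono abs_d_coeff_nonneg n)
    then have "2 * abs_d_coeff n p \<le> n * int (?v p)" by (simp only: int_of_prime_times_abs_d_coeff)
    then have "real_of_int (2 * abs_d_coeff n p) \<le> real_of_int (n * int (?v p))" by (simp only: of_int_le_iff)
    then show ?thesis by simp
  qed
  then have "real_of_int (\<Sum>p\<in>int_supp n. abs_d_coeff n p) \<le> (\<Sum>p\<in>int_supp n. n * real (?v p) / 2)"
    unfolding of_int_sum by (rule sum_mono)
  also have "\<dots> = n * (\<Sum>p\<in>int_supp n. real (?v p)) / 2"
    by (simp add: sum_distrib_left sum_divide_distrib)
  also have "\<dots> \<le> n * (ln n / ln 2) / 2"
    using v n by (intro divide_right_mono mult_left_mono) (simp_all add: field_simps)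
  finally show ?thesis by simp
qed

section \<open>Derivations and their values on the symbols\<close>

lemma hom_expansion:
  assumes "module_hom frag_cmul (*) \<psi>"
  shows "\<psi> y = (\<Sum>p\<in>Poly_Mapping.keys y. Poly_Mapping.lookup y p * \<psi> (frag_of p))"
proof -
  interpret module_hom frag_cmul "(*)" \<psi> by fact
  have "\<psi> y = \<psi> (\<Sum>p\<in>Poly_Mapping.keys y. frag_cmul (Poly_Mapping.lookup y p) (frag_of p))"
    using frag_expansion[of y] by (simp add: frag_extend_def)
  then show ?thesis by (simp add: sum scale)
qed

lemma hom_abs_d:
  assumes hom: "module_hom frag_cmul (*) \<psi>" and n: "n \<noteq> 0" and I: "finite I" "int_supp n \<subseteq> I"
  shows "\<psi> (abs_d n) = (\<Sum>p\<in>I. abs_d_coeff n p * \<psi> (frag_of p))"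
proof -
  interpret module_hom frag_cmul "(*)" \<psi> by fact
  have "\<psi> (abs_d n) = (\<Sum>p\<in>int_supp n. abs_d_coeff n p * \<psi> (frag_of p))"
    using n by (simp add: abs_d_def sum scale abs_d_coeff_def)
  also have "\<dots> = (\<Sum>p\<in>I. abs_d_coeff n p * \<psi> (frag_of p))"
    using I by (intro sum.mono_neutral_left) (auto simp: abs_d_coeff_eq_0)
  finally show ?thesis .
qed

text \<open>A combination of coordinate functionals, which makes linearity immediate. For finite
  \<open>I\<close> and \<open>f\<close> vanishing off \<open>I\<close>, its values on the symbols
  are those of \<open>f\<close>.\<close>

definition hom_of_values :: "prime_nat set \<Rightarrow> (prime_nat \<Rightarrow> int) \<Rightarrow> omega \<Rightarrow> int"
  where "hom_of_values I f y = (\<Sum>p\<in>I. f p * Poly_Mapping.lookup y p)"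

lemma module_hom_hom_of_values: "module_hom frag_cmul (*) (hom_of_values I f)"
  unfolding omega_linear_iff
  by (simp add: hom_of_values_def lookup_add distrib_left sum.distrib sum_distrib_left mult.left_commute)

lemma hom_of_values_frag_of:
  assumes "finite I" "\<And>p. p \<notin> I \<Longrightarrow> f p = 0"
  shows "hom_of_values I f (frag_of q) = f q"
proof -
  have "hom_of_values I f (frag_of q) = (\<Sum>p\<in>I. if p = q then f p else 0)"
    unfolding hom_of_values_def by (intro sum.cong) (auto simp: lookup_single)
  then show ?thesis using assms by simp
qed

lemma deriv_norm_le:
  assumes "\<And>p. \<bar>real_of_int (\<psi> (frag_of p))\<bar> \<le> b"
  shows "deriv_norm \<psi> \<le> b"
  unfolding deriv_norm_def by (rule cSUP_least) (simp_all add: assms)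

lemma deriv_norm_ge_1:
  assumes "\<psi> \<in> derivations" "\<psi> (frag_of p) \<noteq> 0"
  shows "1 \<le> deriv_norm \<psi>"
proof -
  have "1 \<le> \<bar>\<psi> (frag_of p)\<bar>" using assms(2) by linarith
  then have "1 \<le> \<bar>real_of_int (\<psi> (frag_of p))\<bar>" by linarith
  also have "\<dots> \<le> deriv_norm \<psi>"
    unfolding deriv_norm_def using assms(1) by (intro cSUP_upper) (simp_all add: derivations_def)
  finally show ?thesis .
qed

text \<open>Elements of \<open>omega\<close> are finite combinations of symbols, so a relation among
  the values on the symbols is one among the maps.\<close>

lemma int_independent_values:
  assumes ind: "list_independent r \<psi>" and hom: "\<And>k. k \<in> {1..r} \<Longrightarrow> module_hom frag_cmul (*) (\<psi> k)"
  shows "int_independent r (\<lambda>k p. \<psi> k (frag_of p))"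
  unfolding int_independent_def
proof (rule allI, rule impI)
  fix c assume c: "\<forall>p. (\<Sum>k=1..r. c k * \<psi> k (frag_of p)) = 0"
  have "(\<Sum>k=1..r. c k * \<psi> k y) = 0" for y
  proof -
    have "(\<Sum>k=1..r. c k * \<psi> k y) =
        (\<Sum>k=1..r. \<Sum>p\<in>Poly_Mapping.keys y. Poly_Mapping.lookup y p * (c k * \<psi> k (frag_of p)))"
    proof (rule sum.cong)
      fix k assume "k \<in> {1..r}"
      from hom_expansion[OF hom[OF this], of y]
      show "c k * \<psi> k y = (\<Sum>p\<in>Poly_Mapping.keys y. Poly_Mapping.lookup y p * (c k * \<psi> k (frag_of p)))"
        by (simp add: sum_distrib_left mult.left_commute)
    qed simp
    also have "\<dots> = (\<Sum>p\<in>Poly_Mapping.keys y. Poly_Mapping.lookup y p * (\<Sum>k=1..r. c k * \<psi> k (frag_of p)))"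
      by (subst sum.swap) (simp add: sum_distrib_left)
    also have "\<dots> = 0" using c by simp
    finally show ?thesis .
  qed
  then show "\<forall>k\<in>{1..r}. c k = 0"
    using ind unfolding list_independent_iff by blast
qed

lemma list_independent_hom_of_values:
  assumes ind: "int_independent r x" and I: "finite I" and x: "\<And>k p. k \<in> {1..r} \<Longrightarrow> p \<notin> I \<Longrightarrow> x k p = 0"
  shows "list_independent r (\<lambda>k. hom_of_values I (x k))"
  unfolding list_independent_iff
proof (rule allI, rule impI)
  fix c assume c: "\<forall>y. (\<Sum>k=1..r. c k * hom_of_values I (x k) y) = 0"
  have "(\<Sum>k=1..r. c k * x k p) = (\<Sum>k=1..r. c k * hom_of_values I (x k) (frag_of p))" for p
    by (rule sum.cong) (simp_all add: hom_of_values_frag_of I x)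
  then have "\<forall>p. (\<Sum>k=1..r. c k * x k p) = 0" using c by simp
  then show "\<forall>k\<in>{1..r}. c k = 0" using ind unfolding int_independent_def by blast
qed

lemma int_supp_nonempty:
  assumes "n > 1"
  obtains p where "p \<in> int_supp n"
proof -
  have "nat n \<noteq> 1" using assms by simp
  then obtain q where q: "prime q" "q dvd nat n" using prime_factor_nat by blast
  then have "int q dvd n" using assms by (metis int_dvd_int_iff int_nat_eq less_trans less_imp_le zero_less_one)
  then have "Prime_nat q \<in> int_supp n" using q by (simp add: int_supp_def Prime_nat_inverse)
  then show ?thesis by (rule that)
qed

lemma int_supp_disjoint:
  assumes "coprime m n" shows "int_supp m \<inter> int_supp n = {}"
proof -
  have False if "int_of_prime p dvd m" "int_of_prime p dvd n" for p
    using assms that prime_int_of_prime[of p] by (meson coprime_common_divisor not_prime_unit)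
  then show ?thesis by (auto simp: int_supp_def)
qed

lemma int_supp_mult: "int_supp (m * n) = int_supp m \<union> int_supp n"
  using prime_int_of_prime by (auto simp: int_supp_def prime_dvd_mult_iff)

section \<open>The additivity form and the Wronskian of a coprime pair\<close>

context
  fixes a b :: int
  assumes ab: "a > 0" "b > 0" "coprime a b" "(a, b) \<noteq> (1, 1)"
begin

abbreviation (input) S where "S \<equiv> int_supp (a * b * (a + b))"

definition additivity_coeff :: "prime_nat \<Rightarrow> int"
  where "additivity_coeff p = abs_d_coeff (a + b) p - abs_d_coeff a p - abs_d_coeff b p"

lemma S_eq: "S = int_supp a \<union> int_supp b \<union> int_supp (a + b)"
  by (simp add: int_supp_mult)

lemma finite_S: "finite S"
  using ab by (intro finite_int_supp) simp

lemma supports_disjoint: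
  "int_supp a \<inter> int_supp b = {}" "int_supp a \<inter> int_supp (a + b) = {}" "int_supp b \<inter> int_supp (a + b) = {}"
proof -
  have "coprime a (a + b)" using ab(3) by (simp add: add.commute coprime_iff_gcd_eq_1)
  moreover have "coprime b (a + b)"
    using ab(3) by (subst add.commute) (simp add: coprime_iff_gcd_eq_1 gcd.commute)
  ultimately show "int_supp a \<inter> int_supp b = {}" "int_supp a \<inter> int_supp (a + b) = {}"
    "int_supp b \<inter> int_supp (a + b) = {}"
    using ab(3) by (simp_all add: int_supp_disjoint)
qed

text \<open>By coprimality the supports of \<open>a\<close>, \<open>b\<close> and
  \<open>a + b\<close> are disjoint, so exactly one of the three terms survives.\<close>

lemma additivity_coeff_nonzero:
  assumes "p \<in> S" shows "additivity_coeff p \<noteq> 0"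
proof -
  consider "p \<in> int_supp a" | "p \<in> int_supp b" | "p \<in> int_supp (a + b)" using assms S_eq by blast
  then show ?thesis
  proof cases
    case 1
    then have "p \<notin> int_supp b" "p \<notin> int_supp (a + b)" using supports_disjoint by blast+
    then show ?thesis using abs_d_coeff_pos[OF ab(1) 1] by (simp add: additivity_coeff_def abs_d_coeff_eq_0)
  next
    case 2
    then have "p \<notin> int_supp a" "p \<notin> int_supp (a + b)" using supports_disjoint by blast+
    then show ?thesis using abs_d_coeff_pos[OF ab(2) 2] by (simp add: additivity_coeff_def abs_d_coeff_eq_0)
  next
    case 3
    then have "p \<notin> int_supp a" "p \<notin> int_supp b" using supports_disjoint by blast+
    then show ?thesis using abs_d_coeff_pos[OF _ 3] ab by (simp add: additivity_coeff_def abs_d_coeff_eq_0)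
  qed
qed

lemma supp_subset: "int_supp a \<subseteq> S" "int_supp b \<subseteq> S" "int_supp (a + b) \<subseteq> S"
  using S_eq by blast+

lemma d_psi_eq:
  assumes "\<psi> \<in> derivations"
  shows "d_psi \<psi> a = (\<Sum>p\<in>S. abs_d_coeff a p * \<psi> (frag_of p))"
    and "d_psi \<psi> b = (\<Sum>p\<in>S. abs_d_coeff b p * \<psi> (frag_of p))"
    and "d_psi \<psi> (a + b) = (\<Sum>p\<in>S. abs_d_coeff (a + b) p * \<psi> (frag_of p))"
proof -
  have hom: "module_hom frag_cmul (*) \<psi>" using assms by (simp add: derivations_def)
  show "d_psi \<psi> a = (\<Sum>p\<in>S. abs_d_coeff a p * \<psi> (frag_of p))"
    unfolding d_psi_def comp_apply by (rule hom_abs_d[OF hom _ finite_S supp_subset(1)]) (use ab in simp)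
  show "d_psi \<psi> b = (\<Sum>p\<in>S. abs_d_coeff b p * \<psi> (frag_of p))"
    unfolding d_psi_def comp_apply by (rule hom_abs_d[OF hom _ finite_S supp_subset(2)]) (use ab in simp)
  show "d_psi \<psi> (a + b) = (\<Sum>p\<in>S. abs_d_coeff (a + b) p * \<psi> (frag_of p))"
    unfolding d_psi_def comp_apply by (rule hom_abs_d[OF hom _ finite_S supp_subset(3)]) (use ab in simp)
qed

lemma derivations_at_iff:
  "\<psi> \<in> derivations_at a b \<longleftrightarrow> \<psi> \<in> derivations \<and> deriv_supp \<psi> \<subseteq> S \<and>
    (\<Sum>p\<in>S. additivity_coeff p * \<psi> (frag_of p)) = 0"
proof -
  have "d_psi \<psi> (a + b) = d_psi \<psi> a + d_psi \<psi> b \<longleftrightarrow> (\<Sum>p\<in>S. additivity_coeff p * \<psi> (frag_of p)) = 0"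
    if "\<psi> \<in> derivations"
    unfolding d_psi_eq[OF that] additivity_coeff_def left_diff_distrib sum_subtractf by linarith
  then show ?thesis unfolding derivations_at_def by blast
qed

lemma wronskian_eq:
  assumes "\<psi> \<in> derivations"
  shows "wronskian \<psi> a b = (\<Sum>p\<in>S. (a * abs_d_coeff b p - b * abs_d_coeff a p) * \<psi> (frag_of p))"
  unfolding wronskian_def d_psi_eq[OF assms] sum_distrib_left left_diff_distrib sum_subtractf
  by (simp only: mult.assoc)

text \<open>As the pair is not \<open>(1, 1)\<close>, both \<open>a + b\<close> and
  \<open>a * b\<close> exceed 1.\<close>

lemma primes_exist:
  obtains p q where "p \<in> int_supp (a + b)" "q \<in> int_supp a \<union> int_supp b"
proof -
  obtain p where p: "p \<in> int_supp (a + b)" using int_supp_nonempty[of "a + b"] ab by auto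
  have "a * b > 1"
  proof -
    have "a > 1 \<or> b > 1" using ab by auto
    then show ?thesis using ab by (metis less_1_mult mult.right_neutral mult_1 int_one_le_iff_zero_less order_le_less)
  qed
  then obtain q where "q \<in> int_supp (a * b)" by (rule int_supp_nonempty)
  then show ?thesis using that[OF p] by (simp add: int_supp_mult)
qed

lemma card_S_ge_2: "2 \<le> card S"
proof -
  obtain p q where p: "p \<in> int_supp (a + b)" and q: "q \<in> int_supp a \<union> int_supp b" by (rule primes_exist)
  then have "p \<noteq> q" using supports_disjoint by blast
  then have "card {p, q} = 2" by simp
  moreover have "{p, q} \<subseteq> S" using p q S_eq by blast
  ultimately show ?thesis using card_mono[OF finite_S] by metis
qed

text \<open>Replacing \<open>ln a\<close> and \<open>ln b\<close> by \<open>ln (a + b)\<close> makes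
  the contributions of \<open>a\<close> and \<open>b\<close> add up to that of \<open>a + b\<close>.
  The resulting factor 2 is at most \<open>card S\<close>.\<close>

lemma sum_additivity_coeff_le:
  "real_of_int (\<Sum>p\<in>S. \<bar>additivity_coeff p\<bar>) \<le> card S / (2 * ln 2) * ((a + b) * ln (a + b))"
proof -
  have le: "\<bar>additivity_coeff p\<bar> \<le> abs_d_coeff (a + b) p + abs_d_coeff a p + abs_d_coeff b p" for p
    using abs_d_coeff_nonneg[OF ab(1), of p] abs_d_coeff_nonneg[OF ab(2), of p] abs_d_coeff_nonneg[of "a + b" p] ab
    unfolding additivity_coeff_def by linarith
  have sub: "(\<Sum>p\<in>S. abs_d_coeff n p) = (\<Sum>p\<in>int_supp n. abs_d_coeff n p)" if "int_supp n \<subseteq> S" for n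
    using that finite_S by (intro sum.mono_neutral_right) (auto simp: abs_d_coeff_eq_0)
  have "(\<Sum>p\<in>S. \<bar>additivity_coeff p\<bar>) \<le> (\<Sum>p\<in>S. abs_d_coeff (a + b) p + abs_d_coeff a p + abs_d_coeff b p)"
    by (rule sum_mono) (rule le)
  also have "\<dots> = (\<Sum>p\<in>int_supp (a + b). abs_d_coeff (a + b) p) + (\<Sum>p\<in>int_supp a. abs_d_coeff a p) + (\<Sum>p\<in>int_supp b. abs_d_coeff b p)"
    unfolding sum.distrib sub[OF supp_subset(1)] sub[OF supp_subset(2)] sub[OF supp_subset(3)] ..
  finally have "real_of_int (\<Sum>p\<in>S. \<bar>additivity_coeff p\<bar>) \<le>
      real_of_int ((\<Sum>p\<in>int_supp (a + b). abs_d_coeff (a + b) p) + (\<Sum>p\<in>int_supp a. abs_d_coeff a p) + (\<Sum>p\<in>int_supp b. abs_d_coeff b p))"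
    by (simp only: of_int_le_iff)
  also have "\<dots> \<le> (a + b) * ln (a + b) / (2 * ln 2) + a * ln a / (2 * ln 2) + b * ln b / (2 * ln 2)"
    unfolding of_int_add[of "_ + _"] of_int_add[of "sum _ _"]
    using sum_abs_d_coeff_le[of "a + b"] sum_abs_d_coeff_le[OF ab(1)] sum_abs_d_coeff_le[OF ab(2)] ab by (intro add_mono) simp_all
  also have "\<dots> \<le> (a + b) * ln (a + b) / (2 * ln 2) + a * ln (a + b) / (2 * ln 2) + b * ln (a + b) / (2 * ln 2)"
    using ab by (intro add_mono divide_right_mono mult_left_mono order_refl) simp_all
  also have "\<dots> = 2 / (2 * ln 2) * ((a + b) * ln (a + b))"
    by (simp add: field_simps)
  also have "\<dots> \<le> card S / (2 * ln 2) * ((a + b) * ln (a + b))"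
    using card_S_ge_2 ab by (intro mult_right_mono divide_right_mono) simp_all
  finally show ?thesis .
qed

text \<open>Additivity and the vanishing of the Wronskian are two independent linear conditions, as is seen on
  a prime dividing \<open>a + b\<close> and a prime dividing \<open>a b\<close>; together they leave rank \<open>card S - 2\<close>.\<close>

lemma exists_psi_independent:
  assumes \<psi>: "\<And>k. k \<in> {1..card S - 1} \<Longrightarrow> \<psi> k \<in> derivations_at a b"
    and ind: "list_independent (card S - 1) \<psi>"
  shows "\<exists>k\<in>{1..card S - 1}. psi_independent (\<psi> k) a b"
proof (rule ccontr)
  let ?K = "{1..card S - 1}"
  let ?W = "\<lambda>p. a * abs_d_coeff b p - b * abs_d_coeff a p"
  assume "\<not> ?thesis"
  then have wr: "wronskian (\<psi> k) a b = 0" if "k \<in> ?K" for k using that by (simp add: psi_independent_def)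
  have der: "\<psi> k \<in> derivations" "deriv_supp (\<psi> k) \<subseteq> S"
    and add: "(\<Sum>p\<in>S. additivity_coeff p * \<psi> k (frag_of p)) = 0" if "k \<in> ?K" for k
    using \<psi>[OF that] by (simp_all add: derivations_at_iff)
  obtain p q where p: "p \<in> int_supp (a + b)" and q: "q \<in> int_supp a \<union> int_supp b" by (rule primes_exist)
  then have pq: "p \<noteq> q" using supports_disjoint by blast
  have S: "p \<in> S" "q \<in> S" using p q S_eq by blast+
  \<comment> \<open>With \<open>p\<close> and \<open>q\<close> left out, \<open>card S - 2\<close>
    coordinates remain, fewer than there are derivations. So a non-trivial combination vanishes on
    them.\<close>
  have "card (S - {p, q}) < card ?K"
    using card_S_ge_2 S pq finite_S by (simp add: card_Diff_subset)
  then obtain c where c: "\<exists>k\<in>?K. c k \<noteq> 0"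
    and cS: "\<And>s. s \<in> S - {p, q} \<Longrightarrow> (\<Sum>k\<in>?K. c k * \<psi> k (frag_of s)) = 0"
    using integer_relation[of "S - {p, q}" ?K "\<lambda>k s. \<psi> k (frag_of s)"] finite_S by auto
  define y where "y = (\<lambda>s. \<Sum>k\<in>?K. c k * \<psi> k (frag_of s))"
  have y0: "y s = 0" if "s \<notin> {p, q}" for s
  proof (cases "s \<in> S")
    case True
    then show ?thesis using that cS by (simp add: y_def)
  next
    case False
    then have "\<psi> k (frag_of s) = 0" if "k \<in> ?K" for k using der(2)[OF that] by (auto simp: deriv_supp_def)
    then show ?thesis by (simp add: y_def)
  qed
  \<comment> \<open>A linear condition shared by all \<open>\<psi> k\<close> passes to their
    combination \<open>y\<close>, which is supported on \<open>p\<close> and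
    \<open>q\<close>.\<close>
  have two: "f p * y p + f q * y q = 0" if f: "\<And>k. k \<in> ?K \<Longrightarrow> (\<Sum>s\<in>S. f s * \<psi> k (frag_of s)) = 0" for f
  proof -
    have "(\<Sum>s\<in>S. f s * y s) = (\<Sum>s\<in>S. \<Sum>k\<in>?K. c k * (f s * \<psi> k (frag_of s)))"
      by (simp add: y_def sum_distrib_left mult.left_commute)
    also have "\<dots> = (\<Sum>k\<in>?K. c k * (\<Sum>s\<in>S. f s * \<psi> k (frag_of s)))"
      by (subst sum.swap) (simp add: sum_distrib_left)
    also have "\<dots> = 0" using f by simp
    also have "(\<Sum>s\<in>S. f s * y s) = (\<Sum>s\<in>{p, q}. f s * y s)"
      using S finite_S y0 by (intro sum.mono_neutral_right) auto
    finally show ?thesis using pq by simp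
  qed
  \<comment> \<open>As \<open>p\<close> divides neither \<open>a\<close> nor \<open>b\<close>, the
    two conditions form a triangular system: the Wronskian forces \<open>y q = 0\<close>, and
    additivity then \<open>y p = 0\<close>.\<close>
  have Wp: "?W p = 0" using p supports_disjoint by (subst (1 2) abs_d_coeff_eq_0) auto
  have Wq: "?W q \<noteq> 0"
  proof (cases "q \<in> int_supp a")
    case True
    then have "abs_d_coeff b q = 0" using supports_disjoint by (intro abs_d_coeff_eq_0) blast
    then show ?thesis using abs_d_coeff_pos[OF ab(1) True] ab by simp
  next
    case False
    then show ?thesis using q abs_d_coeff_pos[of b q] abs_d_coeff_eq_0[of q a] ab by simp
  qed
  have "?W p * y p + ?W q * y q = 0"
    by (rule two) (use wr wronskian_eq[OF der(1)] in simp)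
  then have yq: "y q = 0" using Wp Wq by simp
  have "additivity_coeff p * y p + additivity_coeff q * y q = 0"
    by (rule two) (rule add)
  then have "y p = 0" using yq additivity_coeff_nonzero[OF S(1)] by simp
  then have "y s = 0" for s using yq y0 by (cases "s \<in> {p, q}") auto
  then have "\<forall>s. (\<Sum>k=1..card S - 1. c k * \<psi> k (frag_of s)) = 0" by (simp add: y_def)
  moreover have "int_independent (card S - 1) (\<lambda>k p. \<psi> k (frag_of p))"
    using der(1) by (intro int_independent_values ind) (simp add: derivations_def)
  ultimately have "\<forall>k\<in>?K. c k = 0" unfolding int_independent_def by blast
  then show False using c by blast
qed

text \<open>Additivity is orthogonality to \<open>additivity_coeff\<close>, so the vectors of
  \<open>small_orthogonal_vectors\<close>, taken as values on the symbols, give the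
  derivations.\<close>

lemma exists_small_derivations:
  "\<exists>\<psi>. (\<forall>k\<in>{1..card S - 1}. \<psi> k \<in> derivations_at a b) \<and> list_independent (card S - 1) \<psi> \<and>
    (\<Prod>k=1..card S - 1. deriv_norm (\<psi> k)) \<le> real_of_int (\<Sum>p\<in>S. \<bar>additivity_coeff p\<bar>)"
proof -
  let ?K = "{1..card S - 1}"
  have "S \<noteq> {}" using card_S_ge_2 by auto
  obtain x \<nu> where ind: "int_independent (card S - 1) x"
    and out: "\<And>k p. k \<in> ?K \<Longrightarrow> p \<notin> S \<Longrightarrow> x k p = 0"
    and le: "\<And>k p. k \<in> ?K \<Longrightarrow> \<bar>x k p\<bar> \<le> \<nu> k"
    and add: "\<And>k. k \<in> ?K \<Longrightarrow> (\<Sum>p\<in>S. additivity_coeff p * x k p) = 0"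
    and pr: "(\<Prod>k\<in>?K. \<nu> k) \<le> (\<Sum>p\<in>S. \<bar>additivity_coeff p\<bar>)"
  proof (rule small_orthogonal_vectors[where A = additivity_coeff, OF finite_S \<open>S \<noteq> {}\<close>])
    show "additivity_coeff p \<noteq> 0" if "p \<in> S" for p
      using that by (rule additivity_coeff_nonzero)
  qed (rule that)
  define \<psi> where "\<psi> = (\<lambda>k. hom_of_values S (x k))"
  have val: "\<psi> k (frag_of p) = x k p" if "k \<in> ?K" for k p
    using hom_of_values_frag_of[OF finite_S out[OF that]] by (simp add: \<psi>_def)
  have bd: "\<bar>real_of_int (\<psi> k (frag_of p))\<bar> \<le> real_of_int (\<nu> k)" if "k \<in> ?K" for k p
    using le[OF that, of p] unfolding val[OF that] by linarith
  have der: "\<psi> k \<in> derivations" if "k \<in> ?K" for k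
  proof -
    from bd[OF that] have "bdd_above (range (\<lambda>p. \<bar>real_of_int (\<psi> k (frag_of p))\<bar>))"
      by (intro bdd_aboveI2)
    then show ?thesis by (simp add: derivations_def \<psi>_def module_hom_hom_of_values)
  qed
  have "\<psi> k \<in> derivations_at a b" if "k \<in> ?K" for k
    unfolding derivations_at_iff deriv_supp_def val[OF that] using der[OF that] out[OF that] add[OF that] by blast
  moreover have "list_independent (card S - 1) \<psi>"
    unfolding \<psi>_def by (rule list_independent_hom_of_values[OF ind finite_S out])
  moreover have "(\<Prod>k\<in>?K. deriv_norm (\<psi> k)) \<le> real_of_int (\<Sum>p\<in>S. \<bar>additivity_coeff p\<bar>)"
  proof -
    have "(\<Prod>k\<in>?K. deriv_norm (\<psi> k)) \<le> (\<Prod>k\<in>?K. real_of_int (\<nu> k))"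
    proof (rule prod_mono)
      fix k assume k: "k \<in> ?K"
      \<comment> \<open>The prime is arbitrary: any value shows that the supremum is
        non-negative.\<close>
      have "0 \<le> \<bar>real_of_int (\<psi> k (frag_of undefined))\<bar>" by simp
      also have "\<dots> \<le> deriv_norm (\<psi> k)"
        unfolding deriv_norm_def using der[OF k] by (intro cSUP_upper) (simp_all add: derivations_def)
      finally have "0 \<le> deriv_norm (\<psi> k)" .
      moreover have "deriv_norm (\<psi> k) \<le> real_of_int (\<nu> k)"
        by (rule deriv_norm_le) (rule bd[OF k])
      ultimately show "0 \<le> deriv_norm (\<psi> k) \<and> deriv_norm (\<psi> k) \<le> real_of_int (\<nu> k)" by simp
    qed
    also have "\<dots> \<le> real_of_int (\<Sum>p\<in>S. \<bar>additivity_coeff p\<bar>)"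
      unfolding of_int_prod[symmetric] using pr by (simp only: of_int_le_iff)
    finally show ?thesis .
  qed
  ultimately show ?thesis by blast
qed

end

text \<open>Independence excludes the zero derivation, and a non-zero integer has absolute value at
  least 1.\<close>

lemma deriv_norm_independent_ge_1:
  assumes ind: "list_independent r \<psi>" and der: "\<And>k. k \<in> {1..r} \<Longrightarrow> \<psi> k \<in> derivations" and k: "k \<in> {1..r}"
  shows "1 \<le> deriv_norm (\<psi> k)"
proof -
  have "int_independent r (\<lambda>k p. \<psi> k (frag_of p))"
    using der by (intro int_independent_values ind) (simp add: derivations_def)
  then have "\<not> (\<forall>p. (\<Sum>l=1..r. (if l = k then 1 else 0) * \<psi> l (frag_of p)) = 0)"
    using k unfolding int_independent_def by force
  then obtain p where "(\<Sum>l=1..r. (if l = k then 1 else 0) * \<psi> l (frag_of p)) \<noteq> 0" by blast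
  also have "(\<Sum>l=1..r. (if l = k then 1 else 0) * \<psi> l (frag_of p)) = (\<Sum>l=1..r. if l = k then \<psi> l (frag_of p) else 0)"
    by (rule sum.cong) auto
  finally have "\<psi> k (frag_of p) \<noteq> 0" using k by simp
  then show ?thesis by (rule deriv_norm_ge_1[OF der[OF k]])
qed

theorem lemma3p5:
  fixes a b c :: int and r :: nat and B :: real
  assumes "a > 0" and "b > 0" and "coprime a b" and "(a, b) \<noteq> (1, 1)"
    and "c = a + b"
    and "r = omega_count (a * b * c) - 1"
    and "B = real (omega_count (a * b * c)) / (2 * ln 2) * (real_of_int c * ln (real_of_int c))"
  shows "r \<ge> 1 \<and>
    (\<forall>\<psi>. (\<forall>i\<in>{1..r}. \<psi> i \<in> derivations_at a b) \<and> list_independent r \<psi> \<longrightarrow>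
      (\<exists>i\<^sub>0\<in>{1..r}. psi_independent (\<psi> i\<^sub>0) a b) \<and>
      ((\<Prod>i=1..r. deriv_norm (\<psi> i)) \<le> B \<longrightarrow>
        (\<forall>i\<^sub>0\<in>{1..r}. psi_independent (\<psi> i\<^sub>0) a b \<longrightarrow> deriv_norm (\<psi> i\<^sub>0) \<le> B))) \<and>
    (\<exists>\<psi>. (\<forall>i\<in>{1..r}. \<psi> i \<in> derivations_at a b) \<and> list_independent r \<psi> \<and>
      (\<Prod>i=1..r. deriv_norm (\<psi> i)) \<le> B)"
proof -
  note ab = assms(1-4)
  have r: "r = card (int_supp (a * b * (a + b))) - 1"
    using assms(5,6) by (simp add: omega_count_def)
  have B: "real_of_int (\<Sum>p\<in>int_supp (a * b * (a + b)). \<bar>additivity_coeff a b p\<bar>) \<le> B"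
    using sum_additivity_coeff_le[OF ab] assms(5,7) by (simp add: omega_count_def)
  have "r \<ge> 1" using card_S_ge_2[OF ab] r by simp
  moreover have "\<exists>i\<in>{1..r}. psi_independent (\<psi> i) a b"
    if "\<forall>i\<in>{1..r}. \<psi> i \<in> derivations_at a b" "list_independent r \<psi>" for \<psi>
    using exists_psi_independent[OF ab, of \<psi>] that unfolding r by blast
  moreover have "deriv_norm (\<psi> i) \<le> B"
    if \<psi>: "\<forall>i\<in>{1..r}. \<psi> i \<in> derivations_at a b" "list_independent r \<psi>"
      and pr: "(\<Prod>i=1..r. deriv_norm (\<psi> i)) \<le> B" and i: "i \<in> {1..r}" for \<psi> i
  proof -
    have ge: "1 \<le> deriv_norm (\<psi> k)" if "k \<in> {1..r}" for k
      using deriv_norm_independent_ge_1[OF \<psi>(2) _ that] \<psi>(1) by (simp add: derivations_at_def)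
    \<comment> \<open>The remaining factors are at least 1, so the product dominates each single
      norm.\<close>
    have "deriv_norm (\<psi> i) * 1 \<le> deriv_norm (\<psi> i) * (\<Prod>k\<in>{1..r} - {i}. deriv_norm (\<psi> k))"
      using ge[OF i] ge by (intro mult_left_mono prod_ge_1) auto
    also have "\<dots> = (\<Prod>k=1..r. deriv_norm (\<psi> k))"
      using i by (simp add: prod.remove)
    finally show ?thesis using pr by simp
  qed
  moreover have "\<exists>\<psi>. (\<forall>i\<in>{1..r}. \<psi> i \<in> derivations_at a b) \<and> list_independent r \<psi> \<and>
      (\<Prod>i=1..r. deriv_norm (\<psi> i)) \<le> B"
    using exists_small_derivations[OF ab] B unfolding r by (meson order_trans)
  ultimately show ?thesis by blast
qed

end
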